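(* Let $M$ be a monoid such that the $\mathcal{J}$-class of the identity is a sofic group $G$, and such that the right translation action of $G$ on $M \setminus G$, given by $(s,g) \mapsto sg$, is locally amenable. Then $M$ is sofic.
   Context: Sofic monoids: Let $M$ be a monoid with identity $1$. For a finite subset $K \subseteq M$ and $\epsilon > 0$, a (left) $(K,\epsilon)$-action of $M$ on a non-empty finite set $X$ is a map $M \times X \to X$, $(m,x) \mapsto m \cdot x$ (not required to be an action) such that: (1) $1 \cdot x = x$ for all $x \in X$; (2) for all $g,h \in K$, the proportion of elements $x \in X$ with $g \cdot (h \cdot x) = (gh)\cdot x$ is at least $1-\epsilon$; (3) for all $g,h \in K$ with $g \neq h$, the proportion of elements $x \in X$ with $g \cdot x = h \cdot x$ is at most $\epsilon$. The monoid $M$ is (left) sofic, or simply sofic, if for every finite $K \subseteq M$ and every $\epsilon > 0$ there exist a non-empty finite set $X$ and a $(K,\epsilon)$-action of $M$ on $X$. A sofic group is a group that is sofic in the usual sense; this is known to be equivalent to being sofic as a monoid, i.e. to the condition that for every finite subset $K$ of the group and every $\epsilon > 0$ there exist a non-empty finite set $X$ and a $(K,\epsilon)$-action of the group on $X$. Green's relation $\mathcal{J}$ on $M$: $x \mathcal{J} y$ if and only if $MxM = MyM$. If the $\mathcal{J}$-class of $1$ is a group $G$ (under the multiplication of $M$), then $G$ is the group of units of $M$ and $M \setminus G$ is an ideal, so $G$ acts on $M \setminus G$ by right translation. Locally amenable action: an action of a group $G$ on a set $X$ is locally amenable if for every orbit in $X$, the quotient of $G$ by the pointwise stabiliser of the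 orbit (a normal subgroup of $G$) is an amenable (discrete) group. *)

theory Defs
  imports Complex_Main "HOL-Algebra.Group_Action" "HOL-Combinatorics.Permutations"
begin

definition proportion :: "'x set \<Rightarrow> ('x \<Rightarrow> bool) \<Rightarrow> real"
  where "proportion X P = real (card {x \<in> X. P x}) / real (card X)"

definition almost_action ::
    "('a, 'b) monoid_scheme \<Rightarrow> 'a set \<Rightarrow> real \<Rightarrow> 'x set \<Rightarrow> ('a \<Rightarrow> 'x \<Rightarrow> 'x) \<Rightarrow> bool"
  where "almost_action M K \<epsilon> X act \<longleftrightarrow>
    (\<forall>m \<in> carrier M. \<forall>x \<in> X. act m x \<in> X) \<and>
    (\<forall>x \<in> X. act \<one>\<^bsub>M\<^esub> x = x) \<and>
    (\<forall>g \<in> K. \<forall>h \<in> K. proportion X (\<lambda>x. act g (act h x) = act (g \<otimes>\<^bsub>M\<^esub> h) x) \<ge> 1 - \<epsilon>) \<and>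
    (\<forall>g \<in> K. \<forall>h \<in> K. g \<noteq> h \<longrightarrow> proportion X (\<lambda>x. act g x = act h x) \<le> \<epsilon>)"

text \<open>A formula cannot quantify over types. The finite sets acted on are therefore taken
  to be sets of natural numbers, here and in the definition of sofic groups. There is no loss of
  generality, since every finite set is in bijection with one of these.\<close>

definition sofic_monoid :: "('a, 'b) monoid_scheme \<Rightarrow> bool"
  where "sofic_monoid M \<longleftrightarrow> monoid M \<and>
    (\<forall>K \<epsilon>. finite K \<and> K \<subseteq> carrier M \<and> \<epsilon> > 0 \<longrightarrow>
      (\<exists>(X :: nat set) act. finite X \<and> X \<noteq> {} \<and> almost_action M K \<epsilon> X act))"

text \<open>Soficity of groups in the usual sense, by almost homomorphisms to finite symmetric groups
  with respect to the normalised Hamming distance.\<close>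

definition hamming_dist :: "'x set \<Rightarrow> ('x \<Rightarrow> 'x) \<Rightarrow> ('x \<Rightarrow> 'x) \<Rightarrow> real"
  where "hamming_dist X \<sigma> \<tau> = proportion X (\<lambda>x. \<sigma> x \<noteq> \<tau> x)"

definition sofic_group :: "('a, 'b) monoid_scheme \<Rightarrow> bool"
  where "sofic_group G \<longleftrightarrow> group G \<and>
    (\<forall>K \<epsilon>. finite K \<and> K \<subseteq> carrier G \<and> \<epsilon> > 0 \<longrightarrow>
      (\<exists>(X :: nat set) \<phi>. finite X \<and> X \<noteq> {} \<and>
        (\<forall>g \<in> carrier G. \<phi> g permutes X) \<and>
        (\<forall>g \<in> K. \<forall>h \<in> K. hamming_dist X (\<phi> (g \<otimes>\<^bsub>G\<^esub> h)) (\<phi> g \<circ> \<phi> h) \<le> \<epsilon>) \<and>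
        (\<forall>g \<in> K. \<forall>h \<in> K. g \<noteq> h \<longrightarrow> hamming_dist X (\<phi> g) (\<phi> h) \<ge> 1 - \<epsilon>)))"

text \<open>Amenability of a discrete group: there is a left-invariant finitely additive probability
  measure defined on all subsets.\<close>

definition amenable_group :: "('a, 'b) monoid_scheme \<Rightarrow> bool"
  where "amenable_group G \<longleftrightarrow> group G \<and>
    (\<exists>\<mu> :: 'a set \<Rightarrow> real.
      \<mu> (carrier G) = 1 \<and>
      (\<forall>A. A \<subseteq> carrier G \<longrightarrow> \<mu> A \<ge> 0) \<and>
      (\<forall>A B. A \<subseteq> carrier G \<and> B \<subseteq> carrier G \<and> A \<inter> B = {} \<longrightarrow> \<mu> (A \<union> B) = \<mu> A + \<mu> B) \<and>
      (\<forall>g \<in> carrier G. \<forall>A. A \<subseteq> carrier G \<longrightarrow> \<mu> (g <#\<^bsub>G\<^esub> A) = \<mu> A))"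

text \<open>Here \<open>\<phi> g x\<close> is the result of acting on \<open>x\<close> by \<open>g\<close>, from either side: neither
  \<^const>\<open>orbits\<close> nor \<^const>\<open>stabilizer\<close> depends on the order in which group elements compose,
  and the pointwise stabiliser of an orbit is a normal subgroup for left and for right actions.\<close>

definition pointwise_stabilizer ::
    "('a, 'b) monoid_scheme \<Rightarrow> ('a \<Rightarrow> 'x \<Rightarrow> 'x) \<Rightarrow> 'x set \<Rightarrow> 'a set"
  where "pointwise_stabilizer G \<phi> Y = {g \<in> carrier G. \<forall>y \<in> Y. g \<in> stabilizer G \<phi> y}"

definition locally_amenable ::
    "('a, 'b) monoid_scheme \<Rightarrow> 'x set \<Rightarrow> ('a \<Rightarrow> 'x \<Rightarrow> 'x) \<Rightarrow> bool"
  where "locally_amenable G X \<phi> \<longleftrightarrow>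
    (\<forall>Y \<in> orbits G X \<phi>. amenable_group (G Mod pointwise_stabilizer G \<phi> Y))"

definition principal_two_sided_ideal :: "('a, 'b) monoid_scheme \<Rightarrow> 'a \<Rightarrow> 'a set"
  where "principal_two_sided_ideal M x =
    {a \<otimes>\<^bsub>M\<^esub> x \<otimes>\<^bsub>M\<^esub> b | a b. a \<in> carrier M \<and> b \<in> carrier M}"

definition J_class :: "('a, 'b) monoid_scheme \<Rightarrow> 'a \<Rightarrow> 'a set"
  where "J_class M x =
    {y \<in> carrier M. principal_two_sided_ideal M x = principal_two_sided_ideal M y}"

end

theory Submission
  imports Defs
begin

text \<open>Write \<open>I = M - G\<close>. Since \<open>G\<close> is the \<open>J\<close>-class of \<open>1\<close>, a product lies in \<open>G\<close> only if both factors do, so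
  \<open>I\<close> is an ideal, and the elements of \<open>G\<close> are units.

  If \<open>G\<close> is trivial, every monoid of this shape is sofic for a cheap reason: take a huge finite
  set \<open>Z\<close>, glue a negligible finite set \<open>E \<subseteq> I\<close> to it, and let \<open>m \<in> I\<close> send all of \<open>Z\<close> to the single
  point \<open>m \<in> E\<close>. The law \<open>g (h z) = (g h) z\<close> for \<open>h \<in> I\<close> is then just the multiplication of \<open>M\<close>, and
  points of \<open>E\<close> are so few that nothing has to be checked there. For general \<open>G\<close> the set \<open>Z\<close> must
  carry an approximate action of \<open>G\<close>, and \<open>s \<in> I\<close> should satisfy \<open>s (g z) = (s g) z\<close>. This is
  achieved by giving each \<open>z \<in> Z\<close> a label \<open>r z \<in> G\<close> with \<open>r (g z) = g (r z)\<close> and putting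
  \<open>s z = s \<cdot> r z \<in> E\<close>. Only finitely many \<open>s\<close> matter, say \<open>s \<in> S\<close>, and \<open>s \<cdot> r z\<close> depends only on the
  class of \<open>r z\<close> modulo the pointwise stabiliser \<open>N\<^sub>s\<close> of the orbit \<open>s G\<close>, so the labels need to be
  equivariant only modulo each \<open>N\<^sub>s\<close>; amenability of \<open>G / N\<^sub>s\<close> makes that possible.

  Concretely, \<open>G\<close> acts diagonally on the set \<open>P\<close> of families in \<open>\<Prod>\<^sub>s G / N\<^sub>s\<close>. Every point stabiliser
  of \<open>P\<close> is the intersection of the \<open>N\<^sub>s\<close>, so a choice of one point in each orbit gives an
  equivariant labelling of \<open>P\<close>; and a product \<open>F \<subseteq> P\<close> of Folner sets is almost invariant. This is
  \<open>joint_Folner_labelling\<close>; it treats all quotients at once, without showing that the quotient by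
  the intersection is amenable. Finally \<open>Z = Y \<times> F \<times> {0, ..., n - 1}\<close>, where \<open>Y\<close> is an approximate
  action of \<open>G\<close> that comes from soficity and separates the elements of \<open>G\<close>, and \<open>n\<close> is large
  compared with \<open>E\<close>, which does not depend on \<open>n\<close>. Distinct \<open>s\<close> and \<open>t\<close> in \<open>I\<close> are separated
  because labels are units, and an element of \<open>G\<close> is separated from an element of \<open>I\<close> because one
  maps almost all of \<open>Z\<close> to \<open>Z\<close> and the other maps it to \<open>E\<close>.

  Folner sets are extracted from an invariant mean as follows (\<open>amenable_group_Folner\<close>). If they do
  not exist, multiplication by some finite set \<open>T\<close> at least doubles the size of every finite set.
  The marriage theorem then yields an injection from two copies of the group into the group that
  moves every point by an element of \<open>T\<close>, that is, a paradoxical decomposition, and the mean would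
  give the group measure at least \<open>2\<close>.\<close>

section \<open>Hall's marriage theorem\<close>

text \<open>Rado's proof of Hall's theorem, which also covers infinite families of finite sets. By Zorn's lemma
  there is a minimal relation that still satisfies Hall's condition; finiteness of the sets is what
  makes the condition survive intersections of chains. In a minimal relation no \<open>v\<close> can have two
  partners \<open>a\<close> and \<open>b\<close>: deleting \<open>(v, a)\<close> or \<open>(v, b)\<close> violates the condition at finite sets \<open>A\<close> and \<open>B\<close>
  containing \<open>v\<close>, and submodularity of the cardinality of images contradicts the condition at
  \<open>A \<union> B\<close> and \<open>A \<inter> B - {v}\<close>.\<close>

lemma hall_marriage_locally_finite:
  fixes N :: "'v \<Rightarrow> 'w set"
  assumes fin: "\<And>v. v \<in> V \<Longrightarrow> finite (N v)"
    and hall: "\<And>J. J \<subseteq> V \<Longrightarrow> finite J \<Longrightarrow> card J \<le> card (\<Union> (N ` J))"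
  obtains f where "inj_on f V" "\<And>v. v \<in> V \<Longrightarrow> f v \<in> N v"
proof -
  define \<A> where "\<A> = {R. R \<subseteq> Sigma V N \<and> (\<forall>J\<subseteq>V. finite J \<longrightarrow> card J \<le> card (R `` J))}"
  have finI: "finite (R `` J)" if "R \<subseteq> Sigma V N" "J \<subseteq> V" "finite J" for R J
  proof (rule finite_subset)
    show "R `` J \<subseteq> \<Union> (N ` J)" using that by auto
    show "finite (\<Union> (N ` J))" using that fin by blast
  qed
  have Sig: "Sigma V N \<in> \<A>"
  proof -
    have "Sigma V N `` J = \<Union> (N ` J)" if "J \<subseteq> V" for J using that by auto
    then show ?thesis unfolding \<A>_def using hall by simp
  qed
  have "\<exists>m\<in>\<A>. \<forall>a\<in>\<A>. a \<subseteq> m \<longrightarrow> a = m"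
  proof (rule predicate_Zorn[where P="\<lambda>a b. b \<subseteq> a"])
    show "partial_order_on \<A> (relation_of (\<lambda>a b. b \<subseteq> a) \<A>)"
      by (rule partial_order_on_relation_ofI) auto
    fix C assume "C \<in> Chains (relation_of (\<lambda>a b. b \<subseteq> a) \<A>)"
    then have CA: "C \<subseteq> \<A>" and chain: "\<And>R R'. R \<in> C \<Longrightarrow> R' \<in> C \<Longrightarrow> R \<subseteq> R' \<or> R' \<subseteq> R"
      unfolding Chains_def relation_of_def by auto
    show "\<exists>u\<in>\<A>. \<forall>a\<in>C. u \<subseteq> a"
    proof (cases "C = {}")
      case True
      then show ?thesis using Sig by auto
    next
      case False
      have "card J \<le> card ((\<Inter>C) `` J)" if J: "J \<subseteq> V" "finite J" for J
      proof -
        let ?r = "\<lambda>R. R \<inter> J \<times> UNIV"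
        \<comment> \<open>Over the finite set \<open>J\<close> the chain stabilises: its smallest trace there is attained.\<close>
        obtain R where R: "R \<in> C" and least: "\<And>R'. R' \<in> C \<Longrightarrow> card (?r R) \<le> card (?r R')"
          using False ex_has_least_nat[of "\<lambda>R. R \<in> C" _ "\<lambda>R. card (?r R)"] by blast
        have fr: "finite (?r R')" if "R' \<in> C" for R'
        proof (rule finite_subset)
          show "?r R' \<subseteq> Sigma J N" using that CA unfolding \<A>_def by auto
          show "finite (Sigma J N)" using J fin by (intro finite_SigmaI) auto
        qed
        have "?r R \<subseteq> R'" if R': "R' \<in> C" for R'
        proof (cases "R \<subseteq> R'")
          case False
          then have "?r R' \<subseteq> ?r R" using chain[OF R R'] by auto
          with least[OF R'] fr[OF R] have "?r R' = ?r R" by (metis card_seteq)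
          then show ?thesis by auto
        qed auto
        then have "R `` J = (\<Inter>C) `` J" using R by fastforce
        moreover have "card J \<le> card (R `` J)" using R CA J unfolding \<A>_def by auto
        ultimately show ?thesis by simp
      qed
      moreover have "\<Inter>C \<subseteq> Sigma V N" using False CA unfolding \<A>_def by auto
      ultimately have "\<Inter>C \<in> \<A>" unfolding \<A>_def by auto
      then show ?thesis by auto
    qed
  qed
  then obtain R where RA: "R \<in> \<A>" and min: "\<And>R'. R' \<in> \<A> \<Longrightarrow> R' \<subseteq> R \<Longrightarrow> R' = R"
    by blast
  have RV: "R \<subseteq> Sigma V N" and RH: "\<And>J. J \<subseteq> V \<Longrightarrow> finite J \<Longrightarrow> card J \<le> card (R `` J)"
    using RA unfolding \<A>_def by auto
  have violated: "\<exists>J\<subseteq>V. finite J \<and> v \<in> J \<and> card ((R - {(v, a)}) `` J) < card J"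
    if "(v, a) \<in> R" for v a
  proof -
    have "R - {(v, a)} \<notin> \<A>" using min[of "R - {(v, a)}"] that by auto
    then obtain J where J: "J \<subseteq> V" "finite J" "\<not> card J \<le> card ((R - {(v, a)}) `` J)"
      using RV unfolding \<A>_def by auto
    have "(R - {(v, a)}) `` J = R `` J" if "v \<notin> J" using that by auto
    with J RH have "v \<in> J" by metis
    with J show ?thesis by (intro exI[of _ J]) auto
  qed
  have unique: "a = b" if ab: "(v, a) \<in> R" "(v, b) \<in> R" for v a b
  proof (rule ccontr)
    assume "a \<noteq> b"
    obtain A where A: "A \<subseteq> V" "finite A" "v \<in> A" "card ((R - {(v, a)}) `` A) < card A"
      using violated[OF ab(1)] by blast
    obtain B where B: "B \<subseteq> V" "finite B" "v \<in> B" "card ((R - {(v, b)}) `` B) < card B"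
      using violated[OF ab(2)] by blast
    let ?A = "(R - {(v, a)}) `` A" and ?B = "(R - {(v, b)}) `` B"
    have f: "finite ?A" "finite ?B"
      using A B RV by (auto intro!: finI)
    have "?A \<union> ?B = R `` (A \<union> B)" using A(3) B(3) \<open>a \<noteq> b\<close> by blast
    then have 1: "card (A \<union> B) \<le> card (?A \<union> ?B)" using RH[of "A \<union> B"] A B by simp
    have "card (A \<inter> B - {v}) \<le> card (R `` (A \<inter> B - {v}))" using RH A B by (metis Diff_subset finite_Diff finite_Int inf.coboundedI1 order.trans)
    also have "\<dots> \<le> card (?A \<inter> ?B)" using f by (intro card_mono) auto
    finally have 2: "card (A \<inter> B) \<le> card (?A \<inter> ?B) + 1" using A B
      by (simp add: card_Diff_singleton)
    have "card A + card B = card (A \<union> B) + card (A \<inter> B)" using A B by (intro card_Un_Int) auto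
    moreover have "card ?A + card ?B = card (?A \<union> ?B) + card (?A \<inter> ?B)"
      using f by (rule card_Un_Int)
    ultimately show False using 1 2 A(4) B(4) by linarith
  qed
  define f where "f v = (SOME a. (v, a) \<in> R)" for v
  have f: "(v, f v) \<in> R" if "v \<in> V" for v
  proof -
    have "card (R `` {v}) \<ge> 1" using RH[of "{v}"] that by simp
    then have "R `` {v} \<noteq> {}" by auto
    then have "\<exists>a. (v, a) \<in> R" by auto
    then show ?thesis unfolding f_def by (rule someI_ex)
  qed
  show ?thesis
  proof
    show "f v \<in> N v" if "v \<in> V" for v using f[OF that] RV by auto
    show "inj_on f V"
    proof (rule inj_onI, rule ccontr)
      fix v w assume vw: "v \<in> V" "w \<in> V" "f v = f w" "v \<noteq> w"
      have "R `` {v, w} = {f v}" using vw f unique by auto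
      moreover have "card {v, w} \<le> card (R `` {v, w})" using vw by (intro RH) auto
      ultimately show False using vw by simp
    qed
  qed
qed

section \<open>Folner sets in amenable groups\<close>

lemma set_mult_finite:
  assumes "finite A" "finite B"
  shows "finite (A <#>\<^bsub>G\<^esub> B)"
  unfolding set_mult_def by (intro finite_UN_I assms) simp

text \<open>Iterating an expansion by the factor \<open>1 + \<delta>\<close> gives an expansion by any factor. The factor \<open>2\<close> is what
  the marriage theorem needs.\<close>

lemma (in group) set_mult_expansion:
  fixes \<delta> :: real
  assumes L: "L \<subseteq> carrier G" "finite L" and "\<delta> > 0"
    and exp: "\<And>F. F \<subseteq> carrier G \<Longrightarrow> finite F \<Longrightarrow> (1 + \<delta>) * card F \<le> card (L <#> F)"
  obtains T where "T \<subseteq> carrier G" "finite T"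
    "\<And>F. F \<subseteq> carrier G \<Longrightarrow> finite F \<Longrightarrow> 2 * card F \<le> card (T <#> F)"
proof -
  have iter: "\<exists>T\<subseteq>carrier G. finite T \<and>
      (\<forall>F\<subseteq>carrier G. finite F \<longrightarrow> (1 + \<delta>) ^ n * card F \<le> card (T <#> F))" for n
  proof (induction n)
    case 0
    have "{\<one>} <#> F = F" if "F \<subseteq> carrier G" for F
      using that by (auto simp: set_mult_def subset_iff)
    then show ?case by (intro exI[of _ "{\<one>}"]) simp
  next
    case (Suc n)
    then obtain T where T: "T \<subseteq> carrier G" "finite T"
      "\<And>F. F \<subseteq> carrier G \<Longrightarrow> finite F \<Longrightarrow> (1 + \<delta>) ^ n * card F \<le> card (T <#> F)" by blast
    have "(1 + \<delta>) ^ Suc n * card F \<le> card ((L <#> T) <#> F)"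
      if F: "F \<subseteq> carrier G" "finite F" for F
    proof -
      have "(1 + \<delta>) ^ Suc n * card F \<le> (1 + \<delta>) * card (T <#> F)"
        using mult_left_mono[OF T(3)[OF F], of "1 + \<delta>"] \<open>\<delta> > 0\<close> by (simp add: mult.assoc)
      also have "\<dots> \<le> card (L <#> (T <#> F))"
        using set_mult_closed[OF T(1) F(1)] set_mult_finite[OF T(2) F(2)] by (rule exp)
      finally show ?thesis unfolding set_mult_assoc[OF L(1) T(1) F(1)] .
    qed
    then show ?case
      using set_mult_closed[OF L(1) T(1)] set_mult_finite[OF L(2) T(2)]
      by (intro exI[of _ "L <#> T"]) blast
  qed
  obtain n where n: "2 < (1 + \<delta>) ^ n"
    using real_arch_pow[of "1 + \<delta>" 2] \<open>\<delta> > 0\<close> by auto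
  obtain T where T: "T \<subseteq> carrier G" "finite T"
    "\<And>F. F \<subseteq> carrier G \<Longrightarrow> finite F \<Longrightarrow> (1 + \<delta>) ^ n * card F \<le> card (T <#> F)"
    using iter[of n] by blast
  have "2 * card F \<le> card (T <#> F)" if F: "F \<subseteq> carrier G" "finite F" for F
  proof -
    have "2 * real (card F) \<le> (1 + \<delta>) ^ n * card F" using n by (intro mult_right_mono) auto
    with T(3)[OF F] have "2 * real (card F) \<le> real (card (T <#> F))" by linarith
    then show ?thesis by linarith
  qed
  then show ?thesis using that T by blast
qed

text \<open>Doubling is Hall's condition for matching each element of two copies of the group with one of its
  translates by \<open>T\<close>. In the resulting injection \<open>f\<close>, the pieces \<open>A (t, b)\<close> on which \<open>f\<close> translates copy \<open>b\<close>
  by \<open>t\<close> partition each copy, while their translates are disjoint in one copy of the group.\<close>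

lemma (in group) doubling_not_amenable:
  assumes T: "T \<subseteq> carrier G" "finite T"
    and dbl: "\<And>F. F \<subseteq> carrier G \<Longrightarrow> finite F \<Longrightarrow> 2 * card F \<le> card (T <#> F)"
  shows "\<not> amenable_group G"
proof
  assume "amenable_group G"
  then obtain \<mu> :: "'a set \<Rightarrow> real" where \<mu>: "\<mu> (carrier G) = 1 \<and>
      (\<forall>A. A \<subseteq> carrier G \<longrightarrow> \<mu> A \<ge> 0) \<and>
      (\<forall>A B. A \<subseteq> carrier G \<and> B \<subseteq> carrier G \<and> A \<inter> B = {} \<longrightarrow> \<mu> (A \<union> B) = \<mu> A + \<mu> B) \<and>
      (\<forall>g \<in> carrier G. \<forall>A. A \<subseteq> carrier G \<longrightarrow> \<mu> (g <#\<^bsub>G\<^esub> A) = \<mu> A)"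
    unfolding amenable_group_def by (elim conjE exE) (rule that, intro conjI)
  have \<mu>1: "\<mu> (carrier G) = 1"
    and pos: "\<And>A. A \<subseteq> carrier G \<Longrightarrow> \<mu> A \<ge> 0"
    and add: "\<And>A B. A \<subseteq> carrier G \<Longrightarrow> B \<subseteq> carrier G \<Longrightarrow> A \<inter> B = {} \<Longrightarrow> \<mu> (A \<union> B) = \<mu> A + \<mu> B"
    and inv: "\<And>g A. g \<in> carrier G \<Longrightarrow> A \<subseteq> carrier G \<Longrightarrow> \<mu> (g <#\<^bsub>G\<^esub> A) = \<mu> A"
    using \<mu> by simp_all
  have \<mu>0: "\<mu> {} = 0" using add[of "{}" "{}"] by simp
  have fadd: "\<mu> (\<Union>i\<in>I. A i) = (\<Sum>i\<in>I. \<mu> (A i))"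
    if "finite I" "\<And>i. i \<in> I \<Longrightarrow> A i \<subseteq> carrier G" "disjoint_family_on A I"
    for I :: "'i set" and A
    using that
  proof (induction I rule: finite_induct)
    case (insert i I)
    have "A i \<inter> (\<Union>i\<in>I. A i) = {}" using insert.hyps insert.prems(2) by (auto simp: disjoint_family_on_def)
    then have "\<mu> (A i \<union> (\<Union>i\<in>I. A i)) = \<mu> (A i) + \<mu> (\<Union>i\<in>I. A i)"
      using insert.prems(1) by (intro add) auto
    moreover have "disjoint_family_on A I" using insert.prems(2) by (auto simp: disjoint_family_on_def)
    ultimately show ?case using insert by auto
  qed (simp add: \<mu>0)
  have mono: "\<mu> A \<le> 1" if "A \<subseteq> carrier G" for A
  proof -
    have "A \<union> (carrier G - A) = carrier G" using that by blast
    with add[OF that, of "carrier G - A"] pos[of "carrier G - A"] \<mu>1 show ?thesis by simp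
  qed
  define V where "V = carrier G \<times> (UNIV :: bool set)"
  define N where "N = (\<lambda>(x, b :: bool). (\<lambda>t. t \<otimes> x) ` T)"
  obtain f where finj: "inj_on f V" and fN: "\<And>v. v \<in> V \<Longrightarrow> f v \<in> N v"
  proof (rule hall_marriage_locally_finite[of V N])
    show "finite (N v)" for v using T by (auto simp: N_def split: prod.split)
    fix J assume J: "J \<subseteq> V" "finite J"
    have "J \<subseteq> fst ` J \<times> UNIV" by force
    then have "card J \<le> card (fst ` J \<times> (UNIV :: bool set))" using J by (intro card_mono) auto
    also have "\<dots> = 2 * card (fst ` J)" by (simp add: card_cartesian_product)
    also have "\<dots> \<le> card (T <#> fst ` J)" using J by (intro dbl) (auto simp: V_def)
    also have "T <#> fst ` J = \<Union> (N ` J)" by (force simp: set_mult_def N_def)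
    finally show "card J \<le> card (\<Union> (N ` J))" .
  qed (rule that)
  define A where "A = (\<lambda>(t, b). {x \<in> carrier G. f (x, b) = t \<otimes> x})"
  have Asub: "A i \<subseteq> carrier G" for i by (auto simp: A_def split: prod.split)
  have whole: "(\<Sum>t\<in>T. \<mu> (A (t, b))) = 1" for b
  proof -
    have "(\<Union>t\<in>T. A (t, b)) = carrier G"
      using fN by (fastforce simp: A_def V_def N_def)
    moreover have "disjoint_family_on (\<lambda>t. A (t, b)) T"
      using T(1) by (auto simp: disjoint_family_on_def A_def subset_iff)
    ultimately show ?thesis using fadd[of T "\<lambda>t. A (t, b)"] T Asub \<mu>1 by auto
  qed
  have "disjoint_family_on (\<lambda>(t, b). t <#\<^bsub>G\<^esub> A (t, b)) (T \<times> UNIV)"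
  proof -
    have *: "\<exists>x\<in>carrier G. y = f (x, b) \<and> f (x, b) = t \<otimes> x" if "y \<in> t <#\<^bsub>G\<^esub> A (t, b)" for y t b
      using that by (clarsimp simp: l_coset_def A_def) metis
    have "t = t' \<and> b = b'" if y: "y \<in> t <#\<^bsub>G\<^esub> A (t, b)" "y \<in> t' <#\<^bsub>G\<^esub> A (t', b')"
      and t: "t \<in> T" "t' \<in> T" for y t b t' b'
    proof -
      obtain x x' where x: "x \<in> carrier G" "y = f (x, b)" "f (x, b) = t \<otimes> x"
        "x' \<in> carrier G" "y = f (x', b')" "f (x', b') = t' \<otimes> x'"
        using *[OF y(1)] *[OF y(2)] by blast
      have "(x, b) = (x', b')"
        using x by (intro inj_onD[OF finj]) (simp_all add: V_def)
      moreover from this x t T(1) have "t = t'" by (metis Pair_inject right_cancel subsetD)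
      ultimately show ?thesis by simp
    qed
    then show ?thesis unfolding disjoint_family_on_def by fast
  qed
  moreover have sub: "t <#\<^bsub>G\<^esub> A (t, b) \<subseteq> carrier G" if "t \<in> T" for t b
    using that T(1) Asub by (intro l_coset_subset_G) auto
  ultimately have "\<mu> (\<Union>(t, b)\<in>T \<times> UNIV. t <#\<^bsub>G\<^esub> A (t, b)) = (\<Sum>(t, b)\<in>T \<times> UNIV. \<mu> (t <#\<^bsub>G\<^esub> A (t, b)))"
    using T sub fadd[of "T \<times> UNIV" "\<lambda>(t, b). t <#\<^bsub>G\<^esub> A (t, b)"] by (simp add: case_prod_unfold mem_Times_iff) (metis prod.collapse)
  also have "\<dots> = (\<Sum>(t, b)\<in>T \<times> UNIV. \<mu> (A (t, b)))"
    using T Asub by (intro sum.cong) (auto simp: inv subsetD)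
  also have "\<dots> = (\<Sum>b\<in>UNIV. \<Sum>t\<in>T. \<mu> (A (t, b)))"
    by (subst sum.swap) (simp add: sum.cartesian_product)
  also have "\<dots> = 2" by (simp add: whole)
  finally have "\<mu> (\<Union>(t, b)\<in>T \<times> UNIV. t <#\<^bsub>G\<^esub> A (t, b)) = 2" .
  moreover have "(\<Union>(t, b)\<in>T \<times> UNIV. t <#\<^bsub>G\<^esub> A (t, b)) \<subseteq> carrier G"
    using sub by blast
  ultimately show False
    using mono[of "\<Union>(t, b)\<in>T \<times> UNIV. t <#\<^bsub>G\<^esub> A (t, b)"] by simp
qed

text \<open>If \<open>F\<close> is not almost invariant under some \<open>k \<in> K\<close>, then \<open>F \<union> k F\<close> is larger than \<open>F\<close> by more than the factor \<open>1 + \<delta>\<close>.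
  So without Folner sets \<open>K \<union> {1}\<close> expands every finite set.\<close>

lemma amenable_group_Folner:
  fixes \<delta> :: real
  assumes am: "amenable_group G" and K: "finite K" "K \<subseteq> carrier G" and \<delta>: "\<delta> > 0"
  obtains F where "finite F" "F \<noteq> {}" "F \<subseteq> carrier G"
    "\<And>k. k \<in> K \<Longrightarrow> card {x \<in> F. k \<otimes>\<^bsub>G\<^esub> x \<notin> F} \<le> \<delta> * card F"
proof (rule ccontr)
  assume none: "\<not> thesis"
  note witness = that
  interpret group G using am unfolding amenable_group_def by blast
  define L where "L = insert \<one>\<^bsub>G\<^esub> K"
  have exp: "(1 + \<delta>) * card F \<le> card (L <#>\<^bsub>G\<^esub> F)" if F: "F \<subseteq> carrier G" "finite F" for F
  proof (cases "F = {}")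
    case True
    then show ?thesis by simp
  next
    case False
    have "\<exists>k\<in>K. \<not> card {x \<in> F. k \<otimes>\<^bsub>G\<^esub> x \<notin> F} \<le> \<delta> * card F"
    proof (rule ccontr)
      assume "\<not> ?thesis"
      then have "thesis" by (intro witness[OF F(2) False F(1)]) blast
      with none show False ..
    qed
    then obtain k where k: "k \<in> K" "\<not> card {x \<in> F. k \<otimes>\<^bsub>G\<^esub> x \<notin> F} \<le> \<delta> * card F"
      by blast
    let ?B = "{x \<in> F. k \<otimes>\<^bsub>G\<^esub> x \<notin> F}"
    have kG: "k \<in> carrier G" using k K by blast
    have "inj_on (\<lambda>x. k \<otimes>\<^bsub>G\<^esub> x) ?B"
      using F kG by (auto simp: inj_on_def subset_iff)
    then have "card ?B + card F = card ((\<lambda>x. k \<otimes>\<^bsub>G\<^esub> x) ` ?B \<union> F)"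
      using F by (subst card_Un_disjoint) (auto simp: card_image)
    also have "\<dots> \<le> card (L <#>\<^bsub>G\<^esub> F)"
    proof (rule card_mono)
      show "finite (L <#>\<^bsub>G\<^esub> F)" using K F by (simp add: L_def set_mult_finite)
      show "(\<lambda>x. k \<otimes>\<^bsub>G\<^esub> x) ` ?B \<union> F \<subseteq> L <#>\<^bsub>G\<^esub> F"
        using F k(1) by (fastforce simp: set_mult_def L_def)
    qed
    finally show ?thesis using k(2) by (simp add: algebra_simps)
  qed
  obtain T where "T \<subseteq> carrier G" "finite T"
    "\<And>F. F \<subseteq> carrier G \<Longrightarrow> finite F \<Longrightarrow> 2 * card F \<le> card (T <#>\<^bsub>G\<^esub> F)"
    using set_mult_expansion[OF _ _ \<delta> exp, of] K by (auto simp: L_def)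
  then show False using doubling_not_amenable am by blast
qed

section \<open>Approximate actions and soficity\<close>

lemma proportion_le_iff:
  fixes c :: real
  assumes "finite X" "X \<noteq> {}"
  shows "proportion X P \<le> c \<longleftrightarrow> card {x \<in> X. P x} \<le> c * card X"
  using assms by (simp add: proportion_def field_simps card_gt_0_iff)

lemma proportion_not:
  assumes "finite X" "X \<noteq> {}"
  shows "proportion X (\<lambda>x. \<not> P x) = 1 - proportion X P"
proof -
  have "card {x \<in> X. P x} + card {x \<in> X. \<not> P x} = card X"
    using assms by (subst card_Un_disjoint[symmetric]) (auto intro!: arg_cong[of _ _ card])
  then have "real (card {x \<in> X. \<not> P x}) = real (card X) - real (card {x \<in> X. P x})"
    by linarith
  then show ?thesis using assms by (simp add: proportion_def diff_divide_distrib)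
qed

lemma almost_actionI:
  fixes \<epsilon> :: real
  assumes X: "finite X" "X \<noteq> {}"
    and "\<And>m x. m \<in> carrier M \<Longrightarrow> x \<in> X \<Longrightarrow> act m x \<in> X"
    and "\<And>x. x \<in> X \<Longrightarrow> act \<one>\<^bsub>M\<^esub> x = x"
    and "\<And>g h. g \<in> K \<Longrightarrow> h \<in> K \<Longrightarrow>
      card {x \<in> X. act g (act h x) \<noteq> act (g \<otimes>\<^bsub>M\<^esub> h) x} \<le> \<epsilon> * card X"
    and "\<And>g h. g \<in> K \<Longrightarrow> h \<in> K \<Longrightarrow> g \<noteq> h \<Longrightarrow> card {x \<in> X. act g x = act h x} \<le> \<epsilon> * card X"
  shows "almost_action M K \<epsilon> X act"
proof -
  have "proportion X (\<lambda>x. act g (act h x) = act (g \<otimes>\<^bsub>M\<^esub> h) x) \<ge> 1 - \<epsilon>"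
    if "g \<in> K" "h \<in> K" for g h
    using assms(5)[OF that] proportion_not[OF X, of "\<lambda>x. act g (act h x) = act (g \<otimes>\<^bsub>M\<^esub> h) x"]
      proportion_le_iff[OF X, of "\<lambda>x. act g (act h x) \<noteq> act (g \<otimes>\<^bsub>M\<^esub> h) x" \<epsilon>]
    by linarith
  then show ?thesis
    using assms unfolding almost_action_def by (simp add: proportion_le_iff[OF X])
qed

lemma almost_actionD:
  fixes \<epsilon> :: real
  assumes X: "finite X" "X \<noteq> {}" and act: "almost_action M K \<epsilon> X act" and K: "g \<in> K" "h \<in> K"
  shows "card {x \<in> X. act g (act h x) \<noteq> act (g \<otimes>\<^bsub>M\<^esub> h) x} \<le> \<epsilon> * card X"
    and "g \<noteq> h \<Longrightarrow> card {x \<in> X. act g x = act h x} \<le> \<epsilon> * card X"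
proof -
  have "proportion X (\<lambda>x. act g (act h x) = act (g \<otimes>\<^bsub>M\<^esub> h) x) \<ge> 1 - \<epsilon>"
    using act K unfolding almost_action_def by blast
  then show "card {x \<in> X. act g (act h x) \<noteq> act (g \<otimes>\<^bsub>M\<^esub> h) x} \<le> \<epsilon> * card X"
    using proportion_not[OF X, of "\<lambda>x. act g (act h x) = act (g \<otimes>\<^bsub>M\<^esub> h) x"]
      proportion_le_iff[OF X, of "\<lambda>x. act g (act h x) \<noteq> act (g \<otimes>\<^bsub>M\<^esub> h) x" \<epsilon>]
    by linarith
  show "card {x \<in> X. act g x = act h x} \<le> \<epsilon> * card X" if "g \<noteq> h"
    using act K that unfolding almost_action_def proportion_le_iff[OF X, symmetric] by blast
qed

text \<open>Finite sets of any type may serve in place of finite sets of natural numbers: an approximate action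
  is transported along an enumeration of the set.\<close>

lemma sofic_monoidI:
  assumes "monoid M"
    and ex: "\<And>K \<epsilon>. finite K \<Longrightarrow> K \<subseteq> carrier M \<Longrightarrow> \<epsilon> > 0 \<Longrightarrow>
      \<exists>(X :: 'x set) act. finite X \<and> X \<noteq> {} \<and> almost_action M K \<epsilon> X act"
  shows "sofic_monoid M"
  unfolding sofic_monoid_def
proof (intro conjI allI impI; (elim conjE)?)
  show "monoid M" by fact
  fix K and \<epsilon> :: real assume K: "finite K" "K \<subseteq> carrier M" "\<epsilon> > 0"
  obtain X :: "'x set" and act where X: "finite X" "X \<noteq> {}" and act: "almost_action M K \<epsilon> X act"
    using ex[OF K] by blast
  obtain e where e: "bij_betw e X {..<card X}"
    using ex_bij_betw_finite_nat[OF X(1)] atLeast0LessThan by metis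
  define d where "d = inv_into X e"
  have de: "d (e x) = x" if "x \<in> X" for x
    using e that by (simp add: d_def bij_betw_def)
  have eX: "e ` X = {..<card X}" using e by (simp add: bij_betw_def)
  have eq: "e x = e y \<longleftrightarrow> x = y" if "x \<in> X" "y \<in> X" for x y
    using de that by metis
  define act' where "act' m y = e (act m (d y))" for m y
  have closed: "act m x \<in> X" if "m \<in> carrier M" "x \<in> X" for m x
    using act that unfolding almost_action_def by blast
  have act': "act' m (e x) = e (act m x)" if "x \<in> X" for m x
    using that by (simp add: act'_def de)
  have trans: "card {y \<in> e ` X. P y} = card {x \<in> X. P (e x)}" for P
  proof -
    have "{y \<in> e ` X. P y} = e ` {x \<in> X. P (e x)}" by auto
    moreover have "inj_on e {x \<in> X. P (e x)}"
      using e by (auto simp: bij_betw_def intro: inj_on_subset)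
    ultimately show ?thesis by (simp add: card_image)
  qed
  have cX: "card (e ` X) = card X" using eX by simp
  have "almost_action M K \<epsilon> (e ` X) act'"
  proof (rule almost_actionI)
    fix g h assume gh: "g \<in> K" "h \<in> K"
    then have gh': "g \<in> carrier M" "h \<in> carrier M" "g \<otimes>\<^bsub>M\<^esub> h \<in> carrier M"
      using K \<open>monoid M\<close> by (auto simp: monoid.m_closed subset_iff)
    have "{x \<in> X. act' g (act' h (e x)) \<noteq> act' (g \<otimes>\<^bsub>M\<^esub> h) (e x)}
        = {x \<in> X. act g (act h x) \<noteq> act (g \<otimes>\<^bsub>M\<^esub> h) x}"
      using closed gh' by (auto simp: act' eq)
    then show "card {x \<in> e ` X. act' g (act' h x) \<noteq> act' (g \<otimes>\<^bsub>M\<^esub> h) x} \<le> \<epsilon> * card (e ` X)"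
      using almost_actionD(1)[OF X act gh] by (simp add: trans cX)
    have "{x \<in> X. act' g (e x) = act' h (e x)} = {x \<in> X. act g x = act h x}"
      using closed gh' by (auto simp: act' eq)
    then show "card {x \<in> e ` X. act' g x = act' h x} \<le> \<epsilon> * card (e ` X)" if "g \<noteq> h"
      using almost_actionD(2)[OF X act gh that] by (simp add: trans cX)
  next
    show "act' m x \<in> e ` X" if "m \<in> carrier M" "x \<in> e ` X" for m x
      using that closed by (auto simp: act')
    show "act' \<one>\<^bsub>M\<^esub> x = x" if "x \<in> e ` X" for x
      using that act by (auto simp: act' almost_action_def)
  qed (use X in auto)
  then show "\<exists>(X :: nat set) act. finite X \<and> X \<noteq> {} \<and> almost_action M K \<epsilon> X act"
    using X by (intro exI[of _ "e ` X"] exI[of _ act']) simp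
qed

text \<open>The only gap between the two notions is that the permutation attached to \<open>1\<close> need not be the
  identity. It nearly is, since it is almost equal to its own square and injective, so it can be
  replaced by the identity at the cost of half of the allowed error.\<close>

lemma sofic_group_imp_sofic_monoid:
  assumes "sofic_group G"
  shows "sofic_monoid G"
  unfolding sofic_monoid_def
proof (intro conjI allI impI; (elim conjE)?)
  interpret group G using assms unfolding sofic_group_def by blast
  show "monoid G" by (rule monoid_axioms)
  fix K and \<epsilon> :: real assume K: "finite K" "K \<subseteq> carrier G" "\<epsilon> > 0"
  have "\<exists>(X :: nat set) \<phi>. finite X \<and> X \<noteq> {} \<and>
        (\<forall>g \<in> carrier G. \<phi> g permutes X) \<and>
        (\<forall>g \<in> insert \<one>\<^bsub>G\<^esub> K. \<forall>h \<in> insert \<one>\<^bsub>G\<^esub> K. hamming_dist X (\<phi> (g \<otimes>\<^bsub>G\<^esub> h)) (\<phi> g \<circ> \<phi> h) \<le> \<epsilon> / 2) \<and>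
        (\<forall>g \<in> insert \<one>\<^bsub>G\<^esub> K. \<forall>h \<in> insert \<one>\<^bsub>G\<^esub> K. g \<noteq> h \<longrightarrow> hamming_dist X (\<phi> g) (\<phi> h) \<ge> 1 - \<epsilon> / 2)"
    using assms K unfolding sofic_group_def
    by (elim conjE allE[of _ "insert \<one>\<^bsub>G\<^esub> K"] allE[of _ "\<epsilon> / 2"]) auto
  then obtain X :: "nat set" and \<phi> where *: "finite X \<and> X \<noteq> {} \<and>
        (\<forall>g \<in> carrier G. \<phi> g permutes X) \<and>
        (\<forall>g \<in> insert \<one>\<^bsub>G\<^esub> K. \<forall>h \<in> insert \<one>\<^bsub>G\<^esub> K. hamming_dist X (\<phi> (g \<otimes>\<^bsub>G\<^esub> h)) (\<phi> g \<circ> \<phi> h) \<le> \<epsilon> / 2) \<and>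
        (\<forall>g \<in> insert \<one>\<^bsub>G\<^esub> K. \<forall>h \<in> insert \<one>\<^bsub>G\<^esub> K. g \<noteq> h \<longrightarrow> hamming_dist X (\<phi> g) (\<phi> h) \<ge> 1 - \<epsilon> / 2)"
    by (elim exE)
  then have X: "finite X" "X \<noteq> {}" by simp_all
  have perm: "\<phi> g permutes X" if "g \<in> carrier G" for g
    using * that by blast
  have mult: "proportion X (\<lambda>x. \<phi> (g \<otimes>\<^bsub>G\<^esub> h) x \<noteq> (\<phi> g \<circ> \<phi> h) x) \<le> \<epsilon> / 2"
    if "g \<in> insert \<one>\<^bsub>G\<^esub> K" "h \<in> insert \<one>\<^bsub>G\<^esub> K" for g h
    using * that unfolding hamming_dist_def by blast
  have sep: "proportion X (\<lambda>x. \<phi> g x \<noteq> \<phi> h x) \<ge> 1 - \<epsilon> / 2"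
    if "g \<in> insert \<one>\<^bsub>G\<^esub> K" "h \<in> insert \<one>\<^bsub>G\<^esub> K" "g \<noteq> h" for g h
    using * that unfolding hamming_dist_def by blast
  have mult': "card {x \<in> X. \<phi> (g \<otimes>\<^bsub>G\<^esub> h) x \<noteq> \<phi> g (\<phi> h x)} \<le> \<epsilon> / 2 * card X"
    if "g \<in> insert \<one>\<^bsub>G\<^esub> K" "h \<in> insert \<one>\<^bsub>G\<^esub> K" for g h
    using mult[OF that] unfolding proportion_le_iff[OF X] o_def .
  have sep': "card {x \<in> X. \<phi> g x = \<phi> h x} \<le> \<epsilon> / 2 * card X"
    if "g \<in> insert \<one>\<^bsub>G\<^esub> K" "h \<in> insert \<one>\<^bsub>G\<^esub> K" "g \<noteq> h" for g h
  proof -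
    have "proportion X (\<lambda>x. \<phi> g x = \<phi> h x) \<le> \<epsilon> / 2"
      using sep[OF that] proportion_not[OF X, of "\<lambda>x. \<phi> g x = \<phi> h x"] by linarith
    then show ?thesis unfolding proportion_le_iff[OF X] .
  qed
  \<comment> \<open>The points that are affected by replacing \<open>\<phi> 1\<close> with the identity.\<close>
  define U where "U = {x \<in> X. \<phi> \<one>\<^bsub>G\<^esub> x \<noteq> x}"
  have U: "card U \<le> \<epsilon> / 2 * card X"
  proof -
    have "\<phi> \<one>\<^bsub>G\<^esub> x = \<phi> \<one>\<^bsub>G\<^esub> (\<phi> \<one>\<^bsub>G\<^esub> x) \<longleftrightarrow> \<phi> \<one>\<^bsub>G\<^esub> x = x" for x
      using permutes_inj[OF perm[OF one_closed]] by (metis injD)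
    then have "U = {x \<in> X. \<phi> (\<one>\<^bsub>G\<^esub> \<otimes>\<^bsub>G\<^esub> \<one>\<^bsub>G\<^esub>) x \<noteq> \<phi> \<one>\<^bsub>G\<^esub> (\<phi> \<one>\<^bsub>G\<^esub> x)}"
      unfolding U_def by simp
    then show ?thesis using mult'[of "\<one>\<^bsub>G\<^esub>" "\<one>\<^bsub>G\<^esub>"] by simp
  qed
  define act where "act g = (if g = \<one>\<^bsub>G\<^esub> then id else \<phi> g)" for g
  have \<phi>: "\<phi> g x = act g x" if "x \<in> X - U" for g x
    using that by (simp add: act_def U_def)
  have half: "card B \<le> \<epsilon> * card X" if "B \<subseteq> A \<union> U" "A \<subseteq> X" "card A \<le> \<epsilon> / 2 * card X" for A B
  proof -
    have "card B \<le> card (A \<union> U)"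
      using that X by (intro card_mono) (auto simp: U_def intro: finite_subset)
    also have "\<dots> \<le> card A + card U" by (rule card_Un_le)
    finally have "real (card B) \<le> real (card A) + real (card U)" by linarith
    also have "\<dots> \<le> \<epsilon> * card X" using that(3) U by simp
    finally show ?thesis .
  qed
  have "almost_action G K \<epsilon> X act"
  proof (rule almost_actionI)
    fix g h assume gh: "g \<in> K" "h \<in> K"
    show "card {x \<in> X. act g (act h x) \<noteq> act (g \<otimes>\<^bsub>G\<^esub> h) x} \<le> \<epsilon> * card X"
    proof (cases "g = \<one>\<^bsub>G\<^esub> \<or> h = \<one>\<^bsub>G\<^esub>")
      case True
      then have "act g (act h x) = act (g \<otimes>\<^bsub>G\<^esub> h) x" for x
        using gh K by (auto simp: act_def subset_iff)
      then show ?thesis using \<open>\<epsilon> > 0\<close> by simp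
    next
      case False
      then have "act g = \<phi> g" "act h = \<phi> h" by (auto simp: act_def)
      then have "{x \<in> X. act g (act h x) \<noteq> act (g \<otimes>\<^bsub>G\<^esub> h) x}
          \<subseteq> {x \<in> X. \<phi> (g \<otimes>\<^bsub>G\<^esub> h) x \<noteq> \<phi> g (\<phi> h x)} \<union> U"
        using \<phi>[of _ "g \<otimes>\<^bsub>G\<^esub> h"] by auto
      then show ?thesis by (rule half) (use gh mult' in auto)
    qed
    have "{x \<in> X. act g x = act h x} \<subseteq> {x \<in> X. \<phi> g x = \<phi> h x} \<union> U"
      using \<phi>[of _ g] \<phi>[of _ h] by auto
    then show "card {x \<in> X. act g x = act h x} \<le> \<epsilon> * card X" if "g \<noteq> h"
      by (rule half) (use gh that sep' in auto)
  next
    show "act m x \<in> X" if "m \<in> carrier G" "x \<in> X" for m x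
      using that permutes_in_image[OF perm] by (auto simp: act_def)
  qed (use X in \<open>auto simp: act_def\<close>)
  then show "\<exists>(X :: nat set) act. finite X \<and> X \<noteq> {} \<and> almost_action G K \<epsilon> X act"
    using X by blast
qed

section \<open>Equivariant labels modulo finitely many normal subgroups\<close>

text \<open>A family leaves a product only by leaving one of the factors, so the proportions of escaping points
  add up.\<close>

lemma card_leaving_PiE:
  fixes \<delta> :: real
  assumes S: "finite S" and F: "\<And>s. s \<in> S \<Longrightarrow> finite (F s)"
    and leave: "\<And>s. s \<in> S \<Longrightarrow> card {x \<in> F s. q s x \<notin> F s} \<le> \<delta> * card (F s)"
  shows "card {p \<in> PiE S F. (\<lambda>s\<in>S. q s (p s)) \<notin> PiE S F} \<le> card S * \<delta> * card (PiE S F)"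
proof -
  define B where "B s = {x \<in> F s. q s x \<notin> F s}" for s
  have B: "card (PiE S (F(s := B s))) \<le> \<delta> * card (PiE S F)" if "s \<in> S" for s
  proof -
    have "card (PiE S (F(s := B s))) = (\<Prod>t\<in>S. card ((F(s := B s)) t))"
      using S by (rule card_PiE)
    also have "\<dots> = card (B s) * (\<Prod>t\<in>S - {s}. card (F t))"
      using S that by (simp add: prod.remove)
    finally have "real (card (PiE S (F(s := B s)))) = card (B s) * real (\<Prod>t\<in>S - {s}. card (F t))"
      by simp
    also have "\<dots> \<le> \<delta> * card (F s) * real (\<Prod>t\<in>S - {s}. card (F t))"
      using leave[OF that] by (intro mult_right_mono) (simp_all add: B_def prod_nonneg)
    also have "\<dots> = \<delta> * card (PiE S F)"
      using S that by (simp add: card_PiE prod.remove)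
    finally show ?thesis .
  qed
  have "card {p \<in> PiE S F. (\<lambda>s\<in>S. q s (p s)) \<notin> PiE S F} \<le> card (\<Union>s\<in>S. PiE S (F(s := B s)))"
  proof (rule card_mono)
    have "finite ((F(s := B s)) t)" if "t \<in> S" for s t
      using F[OF that] by (auto simp: B_def)
    then show "finite (\<Union>s\<in>S. PiE S (F(s := B s)))"
      using S by (intro finite_UN_I finite_PiE) auto
    show "{p \<in> PiE S F. (\<lambda>s\<in>S. q s (p s)) \<notin> PiE S F} \<subseteq> (\<Union>s\<in>S. PiE S (F(s := B s)))"
    proof
      fix p assume p: "p \<in> {p \<in> PiE S F. (\<lambda>s\<in>S. q s (p s)) \<notin> PiE S F}"
      then obtain s where s: "s \<in> S" "q s (p s) \<notin> F s" by (auto simp: PiE_iff)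
      with p have "p \<in> PiE S (F(s := B s))" by (auto simp: PiE_iff B_def)
      with s show "p \<in> (\<Union>s\<in>S. PiE S (F(s := B s)))" by blast
    qed
  qed
  also have "\<dots> \<le> (\<Sum>s\<in>S. card (PiE S (F(s := B s))))" using S by (rule card_UN_le)
  finally have "real (card {p \<in> PiE S F. (\<lambda>s\<in>S. q s (p s)) \<notin> PiE S F})
      \<le> (\<Sum>s\<in>S. real (card (PiE S (F(s := B s)))))"
    unfolding of_nat_sum[symmetric] of_nat_le_iff .
  also have "\<dots> \<le> (\<Sum>s\<in>S. \<delta> * card (PiE S F))" by (intro sum_mono B)
  finally show ?thesis by simp
qed

text \<open>\<open>P\<close> is the product of the quotients \<open>G / N s\<close> with the diagonal left translation \<open>\<alpha>\<close>, and \<open>F\<close> is a product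
  of Folner sets. To label \<open>P\<close>, fix a point \<open>q\<close> in every orbit and let \<open>r p\<close> carry \<open>q\<close> to \<open>p\<close>. The two
  elements \<open>r (\<alpha> g p)\<close> and \<open>g (r p)\<close> carry \<open>q\<close> to the same point, and cancelling \<open>q s\<close> in the group
  \<open>G / N s\<close> shows that they agree modulo \<open>N s\<close>.\<close>

lemma joint_Folner_labelling:
  fixes \<delta> :: real and N :: "'s \<Rightarrow> 'a set" and G (structure)
  assumes G: "group G" and S: "finite S"
    and nrm: "\<And>s. s \<in> S \<Longrightarrow> N s \<lhd> G"
    and am: "\<And>s. s \<in> S \<Longrightarrow> amenable_group (G Mod N s)"
    and L: "finite L" "L \<subseteq> carrier G" and \<delta>: "\<delta> > 0"
  obtains P F :: "('s \<Rightarrow> 'a set) set" and \<alpha> r where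
    "finite F" "F \<noteq> {}" "F \<subseteq> P"
    "\<And>p. p \<in> P \<Longrightarrow> \<alpha> \<one> p = p"
    "\<And>g h p. g \<in> carrier G \<Longrightarrow> h \<in> carrier G \<Longrightarrow> p \<in> P \<Longrightarrow> \<alpha> g (\<alpha> h p) = \<alpha> (g \<otimes> h) p"
    "\<And>p. p \<in> P \<Longrightarrow> r p \<in> carrier G"
    "\<And>g p s. g \<in> carrier G \<Longrightarrow> p \<in> P \<Longrightarrow> s \<in> S \<Longrightarrow> N s #> r (\<alpha> g p) = N s #> (g \<otimes> r p)"
    "\<And>g. g \<in> L \<Longrightarrow> card {p \<in> F. \<alpha> g p \<notin> F} \<le> \<delta> * card F"
proof -
  interpret group G by (rule G)
  have Q: "group (G Mod N s)" if "s \<in> S" for s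
    using normal.factorgroup_is_group[OF nrm[OF that]] .
  have \<pi>: "N s #> g \<in> carrier (G Mod N s)" if "g \<in> carrier G" for s g
    using that by (auto simp: carrier_FactGroup)
  have \<pi>_mult: "(N s #> g) <#> (N s #> h) = N s #> (g \<otimes> h)"
    if "g \<in> carrier G" "h \<in> carrier G" "s \<in> S" for s g h
    using normal.rcos_sum[OF nrm] that by blast
  have \<pi>_one: "N s #> \<one> = N s" if "s \<in> S" for s
    using nrm[OF that] by (simp add: normal_imp_subgroup subgroup.subset)
  define P where "P = PiE S (\<lambda>s. carrier (G Mod N s))"
  define \<alpha> where "\<alpha> g p = (\<lambda>s\<in>S. (N s #> g) <#> p s)" for g p
  have \<alpha>P: "\<alpha> g p \<in> P" if "g \<in> carrier G" "p \<in> P" for g p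
    using that monoid.m_closed[OF group.is_monoid[OF Q] \<pi>]
    unfolding P_def \<alpha>_def by (fastforce simp: PiE_iff)
  have \<alpha>1: "\<alpha> \<one> p = p" if "p \<in> P" for p
  proof
    fix s show "\<alpha> \<one> p s = p s"
      using that monoid.l_one[OF group.is_monoid[OF Q], of s "p s"]
      by (cases "s \<in> S") (auto simp: \<alpha>_def P_def \<pi>_one PiE_iff extensional_def)
  qed
  have \<alpha>\<alpha>: "\<alpha> g (\<alpha> h p) = \<alpha> (g \<otimes> h) p"
    if "g \<in> carrier G" "h \<in> carrier G" "p \<in> P" for g h p
  proof
    fix s show "\<alpha> g (\<alpha> h p) s = \<alpha> (g \<otimes> h) p s"
      using that monoid.m_assoc[OF group.is_monoid[OF Q] \<pi> \<pi>, of s g h "p s"]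
      by (cases "s \<in> S") (auto simp: \<alpha>_def P_def \<pi>_mult PiE_iff)
  qed
  define orb where "orb p = (\<lambda>g. \<alpha> g p) ` carrier G" for p
  define rep where "rep p = (SOME q. q \<in> orb p)" for p
  define r where "r p = (SOME g. g \<in> carrier G \<and> \<alpha> g (rep p) = p)" for p
  have rep: "\<exists>a\<in>carrier G. rep p = \<alpha> a p" if "p \<in> P" for p
  proof -
    have "p \<in> orb p" using \<alpha>1[OF that] by (force simp: orb_def)
    then have "rep p \<in> orb p" unfolding rep_def by (rule someI[of "\<lambda>q. q \<in> orb p"])
    then show ?thesis by (auto simp: orb_def)
  qed
  have repP: "rep p \<in> P" if "p \<in> P" for p
    using rep[OF that] \<alpha>P that by auto
  have r: "r p \<in> carrier G \<and> \<alpha> (r p) (rep p) = p" if p: "p \<in> P" for p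
  proof -
    obtain a where a: "a \<in> carrier G" "rep p = \<alpha> a p" using rep[OF p] by blast
    then have "\<alpha> (inv a) (rep p) = p" using p by (simp add: \<alpha>\<alpha> \<alpha>1)
    with a(1) have "\<exists>g. g \<in> carrier G \<and> \<alpha> g (rep p) = p" by blast
    then show ?thesis unfolding r_def by (rule someI_ex)
  qed
  have rep_eq: "rep (\<alpha> g p) = rep p" if g: "g \<in> carrier G" and p: "p \<in> P" for g p
  proof -
    have "orb (\<alpha> g p) \<subseteq> orb p" using g p by (auto simp: orb_def \<alpha>\<alpha>)
    moreover have "orb p \<subseteq> orb (\<alpha> g p)"
    proof
      fix q assume "q \<in> orb p"
      then obtain h where h: "h \<in> carrier G" "q = \<alpha> h p" by (auto simp: orb_def)
      then have "q = \<alpha> (h \<otimes> inv g) (\<alpha> g p)"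
        using g p by (simp add: \<alpha>\<alpha> m_assoc)
      then show "q \<in> orb (\<alpha> g p)" using h g by (auto simp: orb_def)
    qed
    ultimately show ?thesis by (simp add: rep_def)
  qed
  have equivariant: "N s #> r (\<alpha> g p) = N s #> (g \<otimes> r p)"
    if g: "g \<in> carrier G" and p: "p \<in> P" and s: "s \<in> S" for g p s
  proof -
    let ?q = "rep p"
    have q: "?q s \<in> carrier (G Mod N s)" using repP[OF p] s by (auto simp: P_def PiE_iff)
    have gp: "\<alpha> g p \<in> P" using g p by (rule \<alpha>P)
    have "\<alpha> (r (\<alpha> g p)) ?q = \<alpha> g p" using r[OF gp] rep_eq[OF g p] by simp
    also have "\<dots> = \<alpha> g (\<alpha> (r p) ?q)" using r[OF p] by simp
    also have "\<dots> = \<alpha> (g \<otimes> r p) ?q" using \<alpha>\<alpha>[of g "r p" ?q] g r[OF p] repP[OF p] by blast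
    finally have "\<alpha> (r (\<alpha> g p)) ?q s = \<alpha> (g \<otimes> r p) ?q s" by simp
    then have "(N s #> r (\<alpha> g p)) <#> ?q s = (N s #> (g \<otimes> r p)) <#> ?q s"
      using s by (simp add: \<alpha>_def)
    then show ?thesis
      using group.right_cancel[OF Q[OF s] q \<pi> \<pi>, of "r (\<alpha> g p)" "g \<otimes> r p"] r[OF gp] r[OF p] g
      by simp
  qed
  \<comment> \<open>The losses in the factors add up to at most \<open>card S * \<eta> < \<delta>\<close>; the \<open>1\<close> covers the case of empty \<open>S\<close>.\<close>
  define \<eta> where "\<eta> = \<delta> / (card S + 1)"
  have \<eta>: "\<eta> > 0" using \<delta> by (simp add: \<eta>_def)
  have "\<exists>F. finite F \<and> F \<noteq> {} \<and> F \<subseteq> carrier (G Mod N s) \<and>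
      (\<forall>g\<in>L. card {x \<in> F. (N s #> g) <#> x \<notin> F} \<le> \<eta> * card F)" if s: "s \<in> S" for s
  proof -
    have "finite ((\<lambda>g. N s #> g) ` L)" "(\<lambda>g. N s #> g) ` L \<subseteq> carrier (G Mod N s)"
      using L \<pi> by auto
    then show ?thesis
    proof (rule amenable_group_Folner[OF am[OF s] _ _ \<eta>])
      fix F assume F: "finite F" "F \<noteq> {}" "F \<subseteq> carrier (G Mod N s)"
        "\<And>k. k \<in> (\<lambda>g. N s #> g) ` L \<Longrightarrow> card {x \<in> F. k \<otimes>\<^bsub>G Mod N s\<^esub> x \<notin> F} \<le> \<eta> * card F"
      show ?thesis by (intro exI[of _ F] conjI ballI F(1-3)) (use F(4) in simp)
    qed
  qed
  then have "\<exists>F. \<forall>s\<in>S. finite (F s) \<and> F s \<noteq> {} \<and> F s \<subseteq> carrier (G Mod N s) \<and>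
      (\<forall>g\<in>L. card {x \<in> F s. (N s #> g) <#> x \<notin> F s} \<le> \<eta> * card (F s))"
    by (intro bchoice ballI)
  then obtain F where *: "\<forall>s\<in>S. finite (F s) \<and> F s \<noteq> {} \<and> F s \<subseteq> carrier (G Mod N s) \<and>
      (\<forall>g\<in>L. card {x \<in> F s. (N s #> g) <#> x \<notin> F s} \<le> \<eta> * card (F s))" ..
  have F: "finite (F s)" "F s \<noteq> {}" "F s \<subseteq> carrier (G Mod N s)"
    "\<And>g. g \<in> L \<Longrightarrow> card {x \<in> F s. (N s #> g) <#> x \<notin> F s} \<le> \<eta> * card (F s)"
    if "s \<in> S" for s
    using * that by blast+
  have Folner: "card {p \<in> PiE S F. \<alpha> g p \<notin> PiE S F} \<le> \<delta> * card (PiE S F)" if g: "g \<in> L" for g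
  proof -
    have "card {p \<in> PiE S F. \<alpha> g p \<notin> PiE S F} \<le> card S * \<eta> * card (PiE S F)"
      unfolding \<alpha>_def using S F(1) F(4)[OF _ g] by (rule card_leaving_PiE)
    also have "\<dots> \<le> \<delta> * card (PiE S F)"
      using \<delta> by (intro mult_right_mono) (auto simp: \<eta>_def field_simps)
    finally show ?thesis .
  qed
  show ?thesis
  proof (rule that[of "PiE S F" P \<alpha> r])
    show "finite (PiE S F)" using S F(1) by (rule finite_PiE)
    show "PiE S F \<noteq> {}" using F(2) by (simp add: PiE_eq_empty_iff)
    show "PiE S F \<subseteq> P" unfolding P_def using F(3) by (rule PiE_mono)
  qed (use \<alpha>1 \<alpha>\<alpha> r equivariant Folner in auto)
qed

section \<open>The J-class of the identity and right translation stabilisers\<close>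

lemma (in monoid) J_class_one_iff:
  "y \<in> J_class G \<one> \<longleftrightarrow> y \<in> carrier G \<and> (\<exists>a\<in>carrier G. \<exists>b\<in>carrier G. \<one> = a \<otimes> y \<otimes> b)"
proof -
  have one: "principal_two_sided_ideal G \<one> = carrier G"
  proof
    show "carrier G \<subseteq> principal_two_sided_ideal G \<one>"
      unfolding principal_two_sided_ideal_def by (force intro: r_one[symmetric])
  qed (auto simp: principal_two_sided_ideal_def)
  have "principal_two_sided_ideal G y = carrier G"
    if y: "y \<in> carrier G" and ab: "a \<in> carrier G" "b \<in> carrier G" "\<one> = a \<otimes> y \<otimes> b" for a b
  proof
    show "carrier G \<subseteq> principal_two_sided_ideal G y"
    proof
      fix m assume m: "m \<in> carrier G"
      then have "m = m \<otimes> (a \<otimes> y \<otimes> b)" using ab(3) by (metis r_one)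
      also have "\<dots> = (m \<otimes> a) \<otimes> y \<otimes> b" using m y ab by (simp add: m_assoc)
      finally show "m \<in> principal_two_sided_ideal G y"
        using m ab unfolding principal_two_sided_ideal_def by blast
    qed
  qed (use y in \<open>auto simp: principal_two_sided_ideal_def\<close>)
  moreover have "\<exists>a\<in>carrier G. \<exists>b\<in>carrier G. \<one> = a \<otimes> y \<otimes> b"
    if "principal_two_sided_ideal G y = carrier G"
    using that one_closed unfolding principal_two_sided_ideal_def by blast
  ultimately show ?thesis unfolding J_class_def one by auto
qed

text \<open>Hence the complement of the \<open>J\<close>-class of \<open>1\<close> is a two-sided ideal.\<close>

lemma (in monoid) factors_in_J_class_one:
  assumes ab: "a \<in> carrier G" "b \<in> carrier G" and J: "a \<otimes> b \<in> J_class G \<one>"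
  shows "a \<in> J_class G \<one>" "b \<in> J_class G \<one>"
proof -
  obtain x y where xy: "x \<in> carrier G" "y \<in> carrier G" "\<one> = x \<otimes> (a \<otimes> b) \<otimes> y"
    using J by (auto simp: J_class_one_iff)
  then have "\<one> = x \<otimes> a \<otimes> (b \<otimes> y)" "\<one> = (x \<otimes> a) \<otimes> b \<otimes> y"
    using ab by (simp_all add: m_assoc)
  then show "a \<in> J_class G \<one>" "b \<in> J_class G \<one>"
    using ab xy m_closed unfolding J_class_one_iff by blast+
qed

text \<open>The pointwise stabiliser \<open>N\<close> of the orbit \<open>s H\<close> consists of the \<open>g\<close> with \<open>s a g = s a\<close> for all \<open>a \<in> H\<close>.
  It is normal because \<open>s a (x h x\<^sup>-\<^sup>1) = ((s a x) h) x\<^sup>-\<^sup>1 = s a\<close> for \<open>h \<in> N\<close>, the point \<open>s a x\<close> being in the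
  same orbit. The second part makes right multiplication of \<open>s\<close> a function of the coset.\<close>

lemma right_translation_stabilizer:
  fixes M :: "('a, 'b) monoid_scheme" and G :: "('a, 'b) monoid_scheme"
  assumes "monoid M" and GM: "G = M\<lparr>carrier := H\<rparr>" and "H \<subseteq> carrier M" and "group G"
    and s: "s \<in> carrier M"
  defines "N \<equiv> pointwise_stabilizer G (\<lambda>g s. s \<otimes>\<^bsub>M\<^esub> g) (orbit G (\<lambda>g s. s \<otimes>\<^bsub>M\<^esub> g) s)"
  shows "N \<lhd> G"
    and "\<And>a b. a \<in> H \<Longrightarrow> b \<in> H \<Longrightarrow> N #>\<^bsub>G\<^esub> a = N #>\<^bsub>G\<^esub> b \<Longrightarrow> s \<otimes>\<^bsub>M\<^esub> a = s \<otimes>\<^bsub>M\<^esub> b"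
proof -
  interpret M: monoid M by fact
  interpret G: group G by fact
  have carr: "carrier G = H" and mult: "x \<otimes>\<^bsub>G\<^esub> y = x \<otimes>\<^bsub>M\<^esub> y" and one: "\<one>\<^bsub>G\<^esub> = \<one>\<^bsub>M\<^esub>" for x y
    by (simp_all add: GM)
  have HM: "h \<in> carrier M" if "h \<in> H" for h using that assms by blast
  have HH: "x \<otimes>\<^bsub>M\<^esub> y \<in> H" if "x \<in> H" "y \<in> H" for x y
    using G.m_closed[of x y] that by (simp add: carr mult)
  have oneH: "\<one>\<^bsub>M\<^esub> \<in> H" using G.one_closed by (simp add: carr one)
  have invH: "inv\<^bsub>G\<^esub> x \<in> H" and inv1: "x \<otimes>\<^bsub>M\<^esub> inv\<^bsub>G\<^esub> x = \<one>\<^bsub>M\<^esub>" if "x \<in> H" for x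
    using G.inv_closed[of x] G.r_inv[of x] that by (simp_all add: carr mult one)
  have N: "g \<in> N \<longleftrightarrow> g \<in> H \<and> (\<forall>a\<in>H. s \<otimes>\<^bsub>M\<^esub> (a \<otimes>\<^bsub>M\<^esub> g) = s \<otimes>\<^bsub>M\<^esub> a)" for g
    using s HM unfolding N_def pointwise_stabilizer_def orbit_def stabilizer_def carr
    by (auto simp: M.m_assoc)
  have sub: "subgroup N G"
  proof (rule G.subgroupI)
    show "N \<subseteq> carrier G" using N by (auto simp: carr)
    have "\<one>\<^bsub>M\<^esub> \<in> N" using oneH HM by (simp add: N)
    then show "N \<noteq> {}" by blast
    show "inv\<^bsub>G\<^esub> g \<in> N" if g: "g \<in> N" for g
    proof -
      have gH: "g \<in> H" using g N by blast
      have "s \<otimes>\<^bsub>M\<^esub> (a \<otimes>\<^bsub>M\<^esub> inv\<^bsub>G\<^esub> g) = s \<otimes>\<^bsub>M\<^esub> a" if a: "a \<in> H" for a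
      proof -
        have "a \<otimes>\<^bsub>M\<^esub> inv\<^bsub>G\<^esub> g \<otimes>\<^bsub>M\<^esub> g = a"
          using G.m_assoc[of a "inv\<^bsub>G\<^esub> g" g] G.l_inv[of g] G.r_one[of a] a gH invH
          by (simp add: carr mult one)
        then have "s \<otimes>\<^bsub>M\<^esub> a = s \<otimes>\<^bsub>M\<^esub> (a \<otimes>\<^bsub>M\<^esub> inv\<^bsub>G\<^esub> g \<otimes>\<^bsub>M\<^esub> g)" by simp
        also have "\<dots> = s \<otimes>\<^bsub>M\<^esub> (a \<otimes>\<^bsub>M\<^esub> inv\<^bsub>G\<^esub> g)"
          using g HH[OF a invH[OF gH]] unfolding N by blast
        finally show ?thesis by simp
      qed
      then show ?thesis using gH invH by (simp add: N)
    qed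
    show "g \<otimes>\<^bsub>G\<^esub> h \<in> N" if g: "g \<in> N" and h: "h \<in> N" for g h
    proof -
      have gh: "g \<in> H" "h \<in> H" using g h N by auto
      have "s \<otimes>\<^bsub>M\<^esub> (a \<otimes>\<^bsub>M\<^esub> (g \<otimes>\<^bsub>M\<^esub> h)) = s \<otimes>\<^bsub>M\<^esub> a" if a: "a \<in> H" for a
      proof -
        have "s \<otimes>\<^bsub>M\<^esub> (a \<otimes>\<^bsub>M\<^esub> g \<otimes>\<^bsub>M\<^esub> h) = s \<otimes>\<^bsub>M\<^esub> (a \<otimes>\<^bsub>M\<^esub> g)"
          using h HH[OF a gh(1)] unfolding N by blast
        also have "\<dots> = s \<otimes>\<^bsub>M\<^esub> a" using g a unfolding N by blast
        finally show ?thesis using HM a gh by (simp add: M.m_assoc)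
      qed
      then show ?thesis using gh HH by (simp add: N mult)
    qed
  qed
  show "N \<lhd> G"
  proof (rule G.normal_invI[OF sub])
    fix x h assume x: "x \<in> carrier G" and h: "h \<in> N"
    then have H: "x \<in> H" "h \<in> H" "inv\<^bsub>G\<^esub> x \<in> H" using N invH by (auto simp: carr)
    have "s \<otimes>\<^bsub>M\<^esub> (a \<otimes>\<^bsub>M\<^esub> (x \<otimes>\<^bsub>M\<^esub> h \<otimes>\<^bsub>M\<^esub> inv\<^bsub>G\<^esub> x)) = s \<otimes>\<^bsub>M\<^esub> a" if a: "a \<in> H" for a
    proof -
      have "s \<otimes>\<^bsub>M\<^esub> (a \<otimes>\<^bsub>M\<^esub> (x \<otimes>\<^bsub>M\<^esub> h \<otimes>\<^bsub>M\<^esub> inv\<^bsub>G\<^esub> x))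
          = s \<otimes>\<^bsub>M\<^esub> (a \<otimes>\<^bsub>M\<^esub> x \<otimes>\<^bsub>M\<^esub> h) \<otimes>\<^bsub>M\<^esub> inv\<^bsub>G\<^esub> x"
        using s a H HM by (simp add: M.m_assoc)
      also have "s \<otimes>\<^bsub>M\<^esub> (a \<otimes>\<^bsub>M\<^esub> x \<otimes>\<^bsub>M\<^esub> h) = s \<otimes>\<^bsub>M\<^esub> (a \<otimes>\<^bsub>M\<^esub> x)"
        using h HH[OF a H(1)] unfolding N by blast
      also have "s \<otimes>\<^bsub>M\<^esub> (a \<otimes>\<^bsub>M\<^esub> x) \<otimes>\<^bsub>M\<^esub> inv\<^bsub>G\<^esub> x = s \<otimes>\<^bsub>M\<^esub> a"
        using s a H HM inv1 by (simp add: M.m_assoc)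
      finally show ?thesis .
    qed
    then show "x \<otimes>\<^bsub>G\<^esub> h \<otimes>\<^bsub>G\<^esub> inv\<^bsub>G\<^esub> x \<in> N" using H HH by (simp add: N mult)
  qed
  show "s \<otimes>\<^bsub>M\<^esub> a = s \<otimes>\<^bsub>M\<^esub> b" if ab: "a \<in> H" "b \<in> H" and eq: "N #>\<^bsub>G\<^esub> a = N #>\<^bsub>G\<^esub> b" for a b
  proof -
    have "a \<in> N #>\<^bsub>G\<^esub> a" using G.rcos_self[OF _ sub] ab by (simp add: carr)
    then have "a \<in> N #>\<^bsub>G\<^esub> b" by (simp add: eq)
    then have "\<exists>n\<in>N. a = n \<otimes>\<^bsub>M\<^esub> b" by (auto simp: r_coset_def mult)
    then obtain n where n: "n \<in> N" "a = n \<otimes>\<^bsub>M\<^esub> b" ..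
    then have nH: "n \<in> H" using N by blast
    have "s \<otimes>\<^bsub>M\<^esub> (\<one>\<^bsub>M\<^esub> \<otimes>\<^bsub>M\<^esub> n) = s \<otimes>\<^bsub>M\<^esub> \<one>\<^bsub>M\<^esub>" using n(1) oneH unfolding N by blast
    then have "s \<otimes>\<^bsub>M\<^esub> n = s" using nH HM s by simp
    then show ?thesis using n nH ab HM s M.m_assoc[of s n b] by simp
  qed
qed

section \<open>Extending an approximate action of the unit group\<close>

text \<open>The error count for an approximate action on \<open>Y \<times> F \<times> {..<n}\<close> with a small set \<open>E\<close> attached. A law may
  fail at points with a bad coordinate in \<open>Y\<close>, at points whose coordinate in \<open>F\<close> escapes from \<open>F\<close> under
  either of two group elements, and anywhere in \<open>E\<close>; this makes four errors of size \<open>\<delta>\<close>.\<close>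

lemma card_exceptional_le:
  fixes \<delta> :: real and n :: nat
    and Y :: "'x set" and F :: "'y set" and E :: "'z set" and B :: "('x \<times> 'y \<times> nat + 'z) set"
  assumes fin: "finite Y" "finite F" "finite E"
    and B: "B \<subseteq> Inl ` (A \<times> F \<times> {..<n}) \<union> Inl ` (Y \<times> C \<times> {..<n}) \<union> Inl ` (Y \<times> D \<times> {..<n}) \<union> Inr ` E"
    and AY: "A \<subseteq> Y" "card A \<le> \<delta> * card Y" and CF: "C \<subseteq> F" "card C \<le> \<delta> * card F"
    and DF: "D \<subseteq> F" "card D \<le> \<delta> * card F"
    and E: "card E \<le> \<delta> * n" and "Y \<noteq> {}" "F \<noteq> {}" "\<delta> \<ge> 0"
  shows "card B \<le> 4 * \<delta> * card (Inl ` (Y \<times> F \<times> {..<n}) \<union> Inr ` E)"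
proof -
  let ?c = "real (card Y) * real (card F) * real n"
  have inl: "card (Inl ` U) = card U" for U :: "('x \<times> 'y \<times> nat) set"
    by (simp add: card_image)
  have inr: "card (Inr ` U) = card U" for U :: "'z set"
    by (simp add: card_image)
  have A: "real (card (A \<times> F \<times> {..<n})) \<le> \<delta> * ?c"
    using mult_right_mono[OF AY(2), of "real (card F) * real n"] by (simp add: card_cartesian_product mult_ac)
  have C: "real (card (Y \<times> U \<times> {..<n})) \<le> \<delta> * ?c" if "card U \<le> \<delta> * card F" for U
    using mult_right_mono[OF that, of "real (card Y) * real n"] by (simp add: card_cartesian_product mult_ac)
  have "1 \<le> card Y * card F" using fin \<open>Y \<noteq> {}\<close> \<open>F \<noteq> {}\<close> by (simp add: Suc_le_eq card_gt_0_iff)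
  then have "1 \<le> real (card Y) * real (card F)" by (metis of_nat_1 of_nat_le_iff of_nat_mult)
  then have "\<delta> * n * 1 \<le> \<delta> * n * (real (card Y) * real (card F))"
    using \<open>\<delta> \<ge> 0\<close> by (intro mult_left_mono) auto
  with E have E': "real (card E) \<le> \<delta> * ?c" by (simp add: mult_ac)
  have fins: "finite A" "finite C" "finite D"
    using finite_subset[OF AY(1)] finite_subset[OF CF(1)] finite_subset[OF DF(1)] fin by blast+
  have un: "card (T \<union> U \<union> V \<union> W) \<le> card T + card U + card V + card W"
    for T U V W :: "('x \<times> 'y \<times> nat + 'z) set"
    using card_Un_le[of "T \<union> U \<union> V" W] card_Un_le[of "T \<union> U" V] card_Un_le[of T U] by linarith
  have "card B \<le> card (Inl ` (A \<times> F \<times> {..<n}) \<union> Inl ` (Y \<times> C \<times> {..<n}) \<union> Inl ` (Y \<times> D \<times> {..<n}) \<union> Inr ` E)"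
    using B fins fin by (intro card_mono) simp_all
  also have "\<dots> \<le> card (A \<times> F \<times> {..<n}) + card (Y \<times> C \<times> {..<n}) + card (Y \<times> D \<times> {..<n}) + card E"
    using un[of "Inl ` (A \<times> F \<times> {..<n})" "Inl ` (Y \<times> C \<times> {..<n})" "Inl ` (Y \<times> D \<times> {..<n})" "Inr ` E"]
    by (simp only: inl inr)
  finally have "real (card B) \<le> real (card (A \<times> F \<times> {..<n})) + real (card (Y \<times> C \<times> {..<n}))
      + real (card (Y \<times> D \<times> {..<n})) + real (card E)" by linarith
  also have "\<dots> \<le> 4 * \<delta> * ?c"
    using A C[OF CF(2)] C[OF DF(2)] E' by simp
  also have "?c = real (card (Inl ` (Y \<times> F \<times> {..<n}) :: ('x \<times> 'y \<times> nat + 'z) set))"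
    by (simp add: inl card_cartesian_product)
  also have "4 * \<delta> * \<dots> \<le> 4 * \<delta> * card (Inl ` (Y \<times> F \<times> {..<n}) \<union> Inr ` E)"
    using fin \<open>\<delta> \<ge> 0\<close> by (intro mult_left_mono) (simp_all add: card_mono)
  finally show ?thesis .
qed

theorem theorem3p1:
  fixes M :: "('a, 'b) monoid_scheme" and G :: "('a, 'b) monoid_scheme"
  assumes "monoid M"
    and "G = M\<lparr>carrier := J_class M \<one>\<^bsub>M\<^esub>\<rparr>"
    and "sofic_group G"
    and "locally_amenable G (carrier M - carrier G) (\<lambda>g s. s \<otimes>\<^bsub>M\<^esub> g)"
  shows "sofic_monoid M"
proof -
  interpret M: monoid M by fact
  define H where "H = J_class M \<one>\<^bsub>M\<^esub>"
  have GM: "G = M\<lparr>carrier := H\<rparr>" by (simp add: H_def assms(2))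
  have carr: "carrier G = H" and mult: "x \<otimes>\<^bsub>G\<^esub> y = x \<otimes>\<^bsub>M\<^esub> y" and one: "\<one>\<^bsub>G\<^esub> = \<one>\<^bsub>M\<^esub>" for x y
    by (simp_all add: GM)
  interpret G: group G using assms(3) by (simp add: sofic_group_def)
  have HM: "H \<subseteq> carrier M" by (auto simp: H_def J_class_def)
  have HH: "g \<otimes>\<^bsub>M\<^esub> h \<in> H \<longleftrightarrow> g \<in> H \<and> h \<in> H" if "g \<in> carrier M" "h \<in> carrier M" for g h
    using M.factors_in_J_class_one[OF that] G.m_closed[of g h] by (auto simp: carr mult H_def)
  have oneH: "\<one>\<^bsub>M\<^esub> \<in> H" using G.one_closed by (simp add: carr one)
  have cancel: "s = t" if "s \<in> carrier M" "t \<in> carrier M" "a \<in> H" "s \<otimes>\<^bsub>M\<^esub> a = t \<otimes>\<^bsub>M\<^esub> a" for s t a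
  proof -
    have inv: "inv\<^bsub>G\<^esub> a \<in> H" "a \<otimes>\<^bsub>M\<^esub> inv\<^bsub>G\<^esub> a = \<one>\<^bsub>M\<^esub>"
      using G.inv_closed[of a] G.r_inv[of a] that by (simp_all add: carr mult one)
    have "u = u \<otimes>\<^bsub>M\<^esub> a \<otimes>\<^bsub>M\<^esub> inv\<^bsub>G\<^esub> a" if "u \<in> carrier M" for u
      using that \<open>a \<in> H\<close> inv HM by (simp add: M.m_assoc subset_iff)
    then show ?thesis using that by metis
  qed
  define N where "N s = pointwise_stabilizer G (\<lambda>g s. s \<otimes>\<^bsub>M\<^esub> g) (orbit G (\<lambda>g s. s \<otimes>\<^bsub>M\<^esub> g) s)" for s
  have N: "N s \<lhd> G" "\<And>a b. a \<in> H \<Longrightarrow> b \<in> H \<Longrightarrow> N s #>\<^bsub>G\<^esub> a = N s #>\<^bsub>G\<^esub> b \<Longrightarrow> s \<otimes>\<^bsub>M\<^esub> a = s \<otimes>\<^bsub>M\<^esub> b"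
    if "s \<in> carrier M" for s
    using right_translation_stabilizer[OF assms(1) GM HM G.group_axioms that] unfolding N_def by blast+
  have amen: "amenable_group (G Mod N s)" if "s \<in> carrier M - H" for s
    using assms(4) that unfolding locally_amenable_def orbits_def N_def carr by blast
  show ?thesis
  proof (rule sofic_monoidI)
    show "monoid M" by fact
    fix K and \<epsilon> :: real assume K: "finite K" "K \<subseteq> carrier M" and \<epsilon>: "\<epsilon> > 0"
    \<comment> \<open>Products of two elements of \<open>K\<close> act as well in the laws to be verified.\<close>
    define KK where "KK = K \<union> (\<lambda>(g, h). g \<otimes>\<^bsub>M\<^esub> h) ` (K \<times> K)"
    have KK: "finite KK" "KK \<subseteq> carrier M" "K \<subseteq> KK" and prodK: "\<And>g h. g \<in> K \<Longrightarrow> h \<in> K \<Longrightarrow> g \<otimes>\<^bsub>M\<^esub> h \<in> KK"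
      using K by (auto simp: KK_def)
    define S where "S = KK - H"
    have S: "finite S" "S \<subseteq> carrier M - H" using KK by (auto simp: S_def)
    define \<delta> where "\<delta> = \<epsilon> / 4"
    have \<delta>: "\<delta> > 0" using \<epsilon> by (simp add: \<delta>_def)
    have "finite (K \<inter> H)" "K \<inter> H \<subseteq> carrier G" using K by (auto simp: carr)
    then obtain Y :: "nat set" and \<psi> where Y: "finite Y" "Y \<noteq> {}"
      and \<psi>: "almost_action G (K \<inter> H) \<delta> Y \<psi>"
      using sofic_group_imp_sofic_monoid[OF assms(3)] \<delta> unfolding sofic_monoid_def by metis
    have \<psi>_closed: "\<psi> g y \<in> Y" if "g \<in> H" "y \<in> Y" for g y
      using \<psi> that unfolding almost_action_def carr by blast
    have \<psi>_one: "\<psi> \<one>\<^bsub>M\<^esub> y = y" if "y \<in> Y" for y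
      using \<psi> that unfolding almost_action_def one by blast
    have nrm: "N s \<lhd> G" and am: "amenable_group (G Mod N s)" if "s \<in> S" for s
      using that S N amen by blast+
    have L: "finite (KK \<inter> H)" "KK \<inter> H \<subseteq> carrier G" using KK by (auto simp: carr)
    show "\<exists>(X :: (nat \<times> ('a \<Rightarrow> 'a set) \<times> nat + 'a) set) act.
      finite X \<and> X \<noteq> {} \<and> almost_action M K \<epsilon> X act"
    proof (rule joint_Folner_labelling[OF G.group_axioms S(1) nrm am L \<delta>])
      fix P F :: "('a \<Rightarrow> 'a set) set" and \<alpha> r
      assume F: "finite F" "F \<noteq> {}" "F \<subseteq> P"
        and \<alpha>1': "\<And>p. p \<in> P \<Longrightarrow> \<alpha> \<one>\<^bsub>G\<^esub> p = p"
        and \<alpha>\<alpha>': "\<And>g h p. g \<in> carrier G \<Longrightarrow> h \<in> carrier G \<Longrightarrow> p \<in> P \<Longrightarrow> \<alpha> g (\<alpha> h p) = \<alpha> (g \<otimes>\<^bsub>G\<^esub> h) p"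
        and r': "\<And>p. p \<in> P \<Longrightarrow> r p \<in> carrier G"
        and equivariant: "\<And>g p s. g \<in> carrier G \<Longrightarrow> p \<in> P \<Longrightarrow> s \<in> S \<Longrightarrow>
          N s #>\<^bsub>G\<^esub> r (\<alpha> g p) = N s #>\<^bsub>G\<^esub> (g \<otimes>\<^bsub>G\<^esub> r p)"
        and Folner: "\<And>g. g \<in> KK \<inter> H \<Longrightarrow> card {p \<in> F. \<alpha> g p \<notin> F} \<le> \<delta> * card F"
      have \<alpha>1: "\<alpha> \<one>\<^bsub>M\<^esub> p = p" if "p \<in> F" for p
        using \<alpha>1'[of p] F that by (auto simp: one)
      have \<alpha>\<alpha>: "\<alpha> g (\<alpha> h p) = \<alpha> (g \<otimes>\<^bsub>M\<^esub> h) p" if "g \<in> H" "h \<in> H" "p \<in> F" for g h p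
        using \<alpha>\<alpha>'[of g h p] F that by (auto simp: carr mult)
      have r: "r p \<in> H" "r p \<in> carrier M" if "p \<in> F" for p
        using r'[of p] F HM that by (auto simp: carr)
      have s_r: "s \<otimes>\<^bsub>M\<^esub> r (\<alpha> g p) = s \<otimes>\<^bsub>M\<^esub> g \<otimes>\<^bsub>M\<^esub> r p"
        if s: "s \<in> S" and g: "g \<in> H" and p: "p \<in> F" "\<alpha> g p \<in> F" for s g p
      proof -
        have M: "s \<in> carrier M" "g \<in> carrier M" using s g S HM by blast+
        have "s \<otimes>\<^bsub>M\<^esub> r (\<alpha> g p) = s \<otimes>\<^bsub>M\<^esub> (g \<otimes>\<^bsub>M\<^esub> r p)"
          using equivariant[of g p s] s g p F HH[OF M(2) r(2)[OF p(1)]] r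
          by (intro N(2)[OF M(1)]) (auto simp: carr mult)
        then show ?thesis using M r(2)[OF p(1)] by (simp add: M.m_assoc)
      qed

      define E where "E = (\<lambda>(s, p). s \<otimes>\<^bsub>M\<^esub> r p) ` (S \<times> F)"
      have E: "finite E" "E \<subseteq> carrier M" using S F r by (auto simp: E_def)
      have inE: "s \<otimes>\<^bsub>M\<^esub> r p \<in> E" if "s \<in> S" "p \<in> F" for s p using that by (auto simp: E_def)
      \<comment> \<open>Only the number of copies \<open>n\<close> is still free, so \<open>E\<close> can be made negligible.\<close>
      obtain n :: nat where n: "card E / \<delta> < n" using reals_Archimedean2 by blast
      have n0: "n > 0"
      proof -
        have "0 \<le> card E / \<delta>" using \<delta> by simp
        with n have "0 < real n" by linarith
        then show ?thesis by simp
      qed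
      have cE: "card E \<le> \<delta> * n" using n \<delta> by (simp add: field_simps)

      define X :: "(nat \<times> ('a \<Rightarrow> 'a set) \<times> nat + 'a) set"
        where "X = Inl ` (Y \<times> F \<times> {..<n}) \<union> Inr ` E"
      have X: "finite X" "X \<noteq> {}" using Y F E n0 by (auto simp: X_def)
      \<comment> \<open>On all of \<open>Y \<times> P \<times> nat + M\<close> the law \<open>g (h x) = (g h) x\<close> holds for \<open>raw\<close> and \<open>g, h \<in> K\<close> wherever it
        holds for \<open>\<psi>\<close>. Cutting down to \<open>X\<close> spoils it only at points that are sent out of \<open>X\<close>.\<close>
      define raw where "raw m x = (case x of
          Inl (y, p, i) \<Rightarrow> if m \<in> H then Inl (\<psi> m y, \<alpha> m p, i) else Inr (m \<otimes>\<^bsub>M\<^esub> r p)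
        | Inr e \<Rightarrow> Inr (m \<otimes>\<^bsub>M\<^esub> e))" for m and x :: "nat \<times> ('a \<Rightarrow> 'a set) \<times> nat + 'a"
      define act where "act m x = (if raw m x \<in> X then raw m x else x)" for m x
      have act_H: "act m (Inl (y, p, i)) = Inl (\<psi> m y, \<alpha> m p, i)"
        if "m \<in> H" "y \<in> Y" "\<alpha> m p \<in> F" "i < n" for m y p i
        using that \<psi>_closed by (simp add: act_def raw_def X_def image_iff)
      have act_S: "act s (Inl (y, p, i)) = Inr (s \<otimes>\<^bsub>M\<^esub> r p)" if "s \<in> S" "p \<in> F" for s y p i
        using that inE[OF that] by (simp add: act_def raw_def X_def S_def)
      have act_E: "act m (Inr e) = Inr (m \<otimes>\<^bsub>M\<^esub> e)" if "m \<otimes>\<^bsub>M\<^esub> e \<in> E" for m e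
        using that by (simp add: act_def raw_def X_def)
      \<comment> \<open>An element of \<open>S\<close> sends \<open>Y \<times> F \<times> {..<n}\<close> into \<open>E\<close>, so no point of \<open>F\<close> is lost.\<close>
      define out where "out m = (if m \<in> H then {p \<in> F. \<alpha> m p \<notin> F} else {})" for m
      have out: "out m \<subseteq> F" "card (out m) \<le> \<delta> * card F" if "m \<in> KK" for m
        using Folner[of m] that \<delta> by (auto simp: out_def)

      have mult_ok: "act g (act h (Inl (y, p, i))) = act (g \<otimes>\<^bsub>M\<^esub> h) (Inl (y, p, i))"
        if g: "g \<in> K" and h: "h \<in> K" and y: "y \<in> Y" and p: "p \<in> F" "p \<notin> out h" "p \<notin> out (g \<otimes>\<^bsub>M\<^esub> h)"
          and i: "i < n" and ok: "g \<in> H \<Longrightarrow> h \<in> H \<Longrightarrow> \<psi> g (\<psi> h y) = \<psi> (g \<otimes>\<^bsub>M\<^esub> h) y" for g h y p i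
      proof -
        have M: "g \<in> carrier M" "h \<in> carrier M" using g h K by blast+
        have gh: "g \<otimes>\<^bsub>M\<^esub> h \<in> H \<longleftrightarrow> g \<in> H \<and> h \<in> H" using M by (rule HH)
        have inS: "g \<otimes>\<^bsub>M\<^esub> h \<in> S" if "g \<notin> H \<or> h \<notin> H" using that gh prodK[OF g h] by (auto simp: S_def)
        show ?thesis
        proof (cases "h \<in> H")
          case True
          then have hp: "\<alpha> h p \<in> F" using p by (auto simp: out_def)
          show ?thesis
          proof (cases "g \<in> H")
            case g': True
            then have ghp: "\<alpha> (g \<otimes>\<^bsub>M\<^esub> h) p \<in> F" using p True gh by (auto simp: out_def)
            with g' True hp y i p ok gh show ?thesis
              by (simp add: act_H \<psi>_closed \<alpha>\<alpha>)
          next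
            case False
            then have "g \<in> S" using g KK by (auto simp: S_def)
            then show ?thesis using True False hp y i p inS s_r by (simp add: act_H act_S)
          qed
        next
          case False
          then have hS: "h \<in> S" using h KK by (auto simp: S_def)
          have "g \<otimes>\<^bsub>M\<^esub> (h \<otimes>\<^bsub>M\<^esub> r p) = g \<otimes>\<^bsub>M\<^esub> h \<otimes>\<^bsub>M\<^esub> r p" using M r(2)[OF p(1)] by (simp add: M.m_assoc)
          then show ?thesis using False hS p inS inE by (simp add: act_S act_E)
        qed
      qed
      have sep_ok: "act g (Inl (y, p, i)) \<noteq> act h (Inl (y, p, i))"
        if g: "g \<in> K" and h: "h \<in> K" and "g \<noteq> h" and y: "y \<in> Y" and p: "p \<in> F" "p \<notin> out g" "p \<notin> out h"
          and i: "i < n" and ok: "g \<in> H \<Longrightarrow> h \<in> H \<Longrightarrow> \<psi> g y \<noteq> \<psi> h y" for g h y p i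
      proof -
        have M: "g \<in> carrier M" "h \<in> carrier M" using g h K by blast+
        have *: "act m (Inl (y, p, i)) = (if m \<in> H then Inl (\<psi> m y, \<alpha> m p, i) else Inr (m \<otimes>\<^bsub>M\<^esub> r p))"
          if "m \<in> K" "p \<notin> out m" for m
          using that y p(1) i KK by (auto simp: act_H act_S S_def out_def)
        show ?thesis
          using *[OF g p(2)] *[OF h p(3)] ok cancel[OF M r(1)[OF p(1)]] \<open>g \<noteq> h\<close> by auto
      qed

      have "almost_action M K \<epsilon> X act"
      proof (rule almost_actionI)
        fix m x assume m: "m \<in> carrier M" and x: "x \<in> X"
        show "act m x \<in> X" using x by (simp add: act_def)
      next
        fix x assume "x \<in> X"
        then have "raw \<one>\<^bsub>M\<^esub> x = x" using E oneH by (auto simp: X_def raw_def \<psi>_one \<alpha>1)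
        then show "act \<one>\<^bsub>M\<^esub> x = x" by (simp add: act_def)
      next
        fix g h assume gh: "g \<in> K" "h \<in> K"
        define A where "A = (if g \<in> H \<and> h \<in> H then {y \<in> Y. \<psi> g (\<psi> h y) \<noteq> \<psi> (g \<otimes>\<^bsub>M\<^esub> h) y} else {})"
        have A: "A \<subseteq> Y" "card A \<le> \<delta> * card Y"
          using almost_actionD(1)[OF Y \<psi>, of g h] gh \<delta> by (auto simp: A_def mult)
        have "{x \<in> X. act g (act h x) \<noteq> act (g \<otimes>\<^bsub>M\<^esub> h) x}
            \<subseteq> Inl ` (A \<times> F \<times> {..<n}) \<union> Inl ` (Y \<times> out h \<times> {..<n})
              \<union> Inl ` (Y \<times> out (g \<otimes>\<^bsub>M\<^esub> h) \<times> {..<n}) \<union> Inr ` E"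
        proof
          fix x assume x: "x \<in> {x \<in> X. act g (act h x) \<noteq> act (g \<otimes>\<^bsub>M\<^esub> h) x}"
          show "x \<in> Inl ` (A \<times> F \<times> {..<n}) \<union> Inl ` (Y \<times> out h \<times> {..<n})
              \<union> Inl ` (Y \<times> out (g \<otimes>\<^bsub>M\<^esub> h) \<times> {..<n}) \<union> Inr ` E"
          proof (cases x)
            case (Inl t)
            obtain y p i where t: "t = (y, p, i)" by (cases t)
            with x Inl have "y \<in> Y" "p \<in> F" "i < n" by (auto simp: X_def)
            moreover have "y \<in> A \<or> p \<in> out h \<or> p \<in> out (g \<otimes>\<^bsub>M\<^esub> h)"
              using x mult_ok[OF gh, of y p i] calculation by (auto simp: Inl t A_def)
            ultimately show ?thesis by (auto simp: Inl t)
          qed (use x in \<open>auto simp: X_def\<close>)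
        qed
        from card_exceptional_le[OF Y(1) F(1) E(1) this A out[of h] out[of "g \<otimes>\<^bsub>M\<^esub> h"] cE Y(2) F(2)]
        show "card {x \<in> X. act g (act h x) \<noteq> act (g \<otimes>\<^bsub>M\<^esub> h) x} \<le> \<epsilon> * card X"
          using gh KK(3) prodK[OF gh] \<delta> by (auto simp: X_def \<delta>_def)
      next
        fix g h assume gh: "g \<in> K" "h \<in> K" and neq: "g \<noteq> h"
        define A where "A = (if g \<in> H \<and> h \<in> H then {y \<in> Y. \<psi> g y = \<psi> h y} else {})"
        have A: "A \<subseteq> Y" "card A \<le> \<delta> * card Y"
          using almost_actionD(2)[OF Y \<psi>, of g h] gh neq \<delta> by (auto simp: A_def)
        have "{x \<in> X. act g x = act h x}
            \<subseteq> Inl ` (A \<times> F \<times> {..<n}) \<union> Inl ` (Y \<times> out g \<times> {..<n})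
              \<union> Inl ` (Y \<times> out h \<times> {..<n}) \<union> Inr ` E"
        proof
          fix x assume x: "x \<in> {x \<in> X. act g x = act h x}"
          show "x \<in> Inl ` (A \<times> F \<times> {..<n}) \<union> Inl ` (Y \<times> out g \<times> {..<n})
              \<union> Inl ` (Y \<times> out h \<times> {..<n}) \<union> Inr ` E"
          proof (cases x)
            case (Inl t)
            obtain y p i where t: "t = (y, p, i)" by (cases t)
            with x Inl have "y \<in> Y" "p \<in> F" "i < n" by (auto simp: X_def)
            moreover have "y \<in> A \<or> p \<in> out g \<or> p \<in> out h"
              using x sep_ok[OF gh neq, of y p i] calculation by (auto simp: Inl t A_def)
            ultimately show ?thesis by (auto simp: Inl t)
          qed (use x in \<open>auto simp: X_def\<close>)
        qed
        from card_exceptional_le[OF Y(1) F(1) E(1) this A out[of g] out[of h] cE Y(2) F(2)]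
        show "card {x \<in> X. act g x = act h x} \<le> \<epsilon> * card X"
          using gh KK(3) \<delta> by (auto simp: X_def \<delta>_def)
      qed (use X in auto)
      then show ?thesis using X by blast
    qed
  qed
qed

end
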